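(* Let $\alpha, \gamma \in \mathbb{R}$, and assume that $\alpha$ is irrational and not Liouville. Then for almost all $\beta \in \mathbb{R}$ (with respect to Lebesgue measure) we have \[ \liminf_{n \to \infty} n (\log n)^2 \, \| n \alpha - \gamma\| \cdot \| n \beta \| = 0. \]
   Context: For $x \in \mathbb{R}$, $\|x\|$ denotes the distance from $x$ to the nearest integer. An irrational real number $\alpha$ is Liouville if $\liminf_{n \to \infty} n^w \| n \alpha \| = 0$ for all $w > 0$. *)

theory Defs
  imports "HOL-Analysis.Analysis"
begin

definition int_dist :: "real \<Rightarrow> real" where
  "int_dist x = infdist x \<int>"

lemma int_dist_eq_round: "int_dist x = \<bar>x - of_int (round x)\<bar>"
proof (rule antisym)
  show "int_dist x \<le> \<bar>x - of_int (round x)\<bar>"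
    unfolding int_dist_def by (rule infdist_le2[of "of_int (round x)"]) (auto simp: dist_real_def)
  show "\<bar>x - of_int (round x)\<bar> \<le> int_dist x"
    unfolding int_dist_def infdist_def
    by (auto intro!: cINF_greatest simp: dist_real_def elim!: Ints_cases)
       (metis abs_minus_commute round_diff_minimal)
qed

text \<open>The limit inferior is taken in the extended reals, since the type of reals is not a
  complete lattice.\<close>

definition Liouville :: "real \<Rightarrow> bool" where
  "Liouville \<alpha> \<longleftrightarrow> \<alpha> \<notin> \<rat> \<and>
     (\<forall>w::real. w > 0 \<longrightarrow>
        liminf (\<lambda>n::nat. ereal (real n powr w * int_dist (real n * \<alpha>))) = 0)"

end

theory Submission
  imports Defs "HOL-Number_Theory.Totient"
begin

text \<open>For \<open>N = B ^ t\<close> and \<open>\<delta> = 4 ^ - j\<close> with \<open>2 \<le> j \<le> t\<close>, the number of \<open>n \<in> {N..<2 * N}\<close> with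
  \<open>int_dist (n * \<alpha> - \<gamma>)\<close> of size \<open>\<delta>\<close> is at least a constant times \<open>\<delta> * N\<close>: since \<open>\<alpha>\<close> is not
  Liouville, Dirichlet's theorem provides a denominator between \<open>8 / \<delta>\<close> and \<open>N\<close>, along which the
  multiples of \<open>\<alpha>\<close> are equidistributed. Applied to \<open>d * \<alpha>\<close>, the same argument bounds the number of
  these \<open>n\<close> that are divisible by \<open>d\<close>, which shows that \<open>totient n / n\<close> is bounded below on average.
  Each pair \<open>(t, j)\<close> therefore contributes about \<open>1 / t\<^sup>2\<close> to the sum of
  \<open>\<psi> n = \<epsilon> / (n * (ln n)\<^sup>2 * int_dist (n * \<alpha> - \<gamma>))\<close>, each \<open>t\<close> contributes about \<open>1 / t\<close>, and the
  sum diverges. Distinct reduced fractions are far apart, so the sets of \<open>\<beta>\<close> within \<open>\<psi> n / n\<close> of a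
  reduced fraction \<open>a / n\<close> are quasi-independent (as in the Duffin--Schaeffer theorem), and the second
  moment method shows that infinitely many of them occur on a set whose measure is bounded below
  independently of \<open>\<epsilon>\<close>. The set where the limit inferior vanishes is invariant under integer
  translations and mapped into itself by doubling, so it has full measure once it is not negligible.\<close>

section \<open>A zero-one law\<close>

text \<open>A substitute for Lebesgue's density theorem: if every interval of an economical dyadic
  cover were filled to at most the fraction \<open>1 - e\<close>, the cover could not hold all of
  \<open>S\<close>. Lengths \<open>1 / 2 ^ n\<close> are wanted because n doublings stretch such an
  interval to length 1.\<close>

lemma exists_dyadic_interval_dense:
  fixes S :: "real set"
  assumes S: "S \<in> lmeasurable" "S \<subseteq> {0..1}" and pos: "measure lebesgue S > 0"
    and e: "0 < e" "e < 1"
  obtains u and n :: nat where "measure lebesgue (S \<inter> {u..u + 1 / 2 ^ n}) > (1 - e) / 2 ^ n"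
proof -
  define m where "m = measure lebesgue S"
  \<comment> \<open>The quarter leaves room for two losses, the excess of the cover and its
    truncation to a finite subfamily: \<open>(1 - e) * (1 + e / 4) + e / 4 < 1\<close>.\<close>
  define e' where "e' = e * m / 4"
  have "e' > 0" using e pos by (simp add: e'_def m_def)
  obtain \<D> where D: "countable \<D>"
      "\<And>K. K \<in> \<D> \<Longrightarrow> K \<subseteq> cbox 0 1 \<and> K \<noteq> {} \<and> (\<exists>c d. K = cbox c d)"
      "pairwise (\<lambda>A B. interior A \<inter> interior B = {}) \<D>"
      "\<And>u v. cbox u v \<in> \<D> \<Longrightarrow> \<exists>n. \<forall>i \<in> Basis. v \<bullet> i - u \<bullet> i = (1 \<bullet> i - 0 \<bullet> i)/2^n"
      "S \<subseteq> \<Union>\<D>" "\<Union>\<D> \<in> lmeasurable" "measure lebesgue (\<Union>\<D>) \<le> m + e'"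
    using measurable_outer_intervals_bounded[of S 0 1 e'] S \<open>e' > 0\<close> unfolding m_def
    by (metis (no_types, lifting) box_real(2))
  have Dm: "K \<in> lmeasurable" if "K \<in> \<D>" for K
    using D(2)[OF that] by auto
  have dy: "\<exists>u n. K = {u..u + 1 / 2 ^ n}" if K: "K \<in> \<D>" for K
  proof -
    obtain c d where "K = cbox c d" "K \<noteq> {}" using D(2)[OF K] by blast
    moreover obtain n where "d - c = 1 / 2 ^ n"
      using D(4)[of c d] K \<open>K = cbox c d\<close> by auto
    ultimately have "K = {c..c + 1 / 2 ^ n}" by (simp add: algebra_simps flip: \<open>d - c = _\<close>)
    then show ?thesis by blast
  qed
  have "\<exists>K\<in>\<D>. measure lebesgue (S \<inter> K) > (1 - e) * measure lebesgue K"
  proof (rule ccontr)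
    assume "\<not> ?thesis"
    then have le: "measure lebesgue (S \<inter> K) \<le> (1 - e) * measure lebesgue K" if "K \<in> \<D>" for K
      using that by force
    obtain D' where D': "D' \<subseteq> \<D>" "finite D'"
        "measure lebesgue (\<Union>\<D>) - e' < measure lebesgue (\<Union>D')"
    proof (rule measure_countable_Union_approachable[OF D(1) \<open>e' > 0\<close> Dm])
      fix D' assume "D' \<subseteq> \<D>" "finite D'"
      then show "measure lebesgue (\<Union>D') \<le> measure lebesgue (\<Union>\<D>)"
        by (intro measure_mono_fmeasurable D(6) Union_mono fmeasurableD fmeasurable.finite_Union)
          (use Dm in auto)
    qed auto
    have D'm: "\<Union>D' \<in> lmeasurable" using D' Dm by (intro fmeasurable.finite_Union) auto
    have negl: "pairwise (\<lambda>S T. negligible (S \<inter> T)) D'"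
    proof (rule pairwiseI)
      fix A B assume AB: "A \<in> D'" "B \<in> D'" "A \<noteq> B"
      then have i: "interior A \<inter> interior B = {}" using D(3) D'(1) by (auto simp: pairwise_def)
      obtain a b where "A = cbox a b" using D(2) D' AB by blast
      moreover obtain c d where "B = cbox c d" using D(2) D' AB by blast
      \<comment> \<open>Intervals with disjoint interiors can meet only in endpoints.\<close>
      ultimately have "A \<inter> B \<subseteq> {a, b, c, d}" using i by (auto simp: interior_cbox)
      then show "negligible (A \<inter> B)"
        by (rule negligible_subset[rotated]) simp
    qed
    have "m \<le> measure lebesgue (S \<inter> \<Union>D') + measure lebesgue (\<Union>\<D> - \<Union>D')"
      unfolding m_def
    proof (rule order.trans[OF measure_mono_fmeasurable measure_Un_le])
      show "S \<subseteq> (S \<inter> \<Union>D') \<union> (\<Union>\<D> - \<Union>D')" using D by auto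
    qed (use S D D'm in \<open>auto intro: fmeasurableD\<close>)
    also have "measure lebesgue (\<Union>\<D> - \<Union>D') = measure lebesgue (\<Union>\<D>) - measure lebesgue (\<Union>D')"
      using D(6) D'm D'(1) by (intro measurable_measure_Diff) (auto intro: fmeasurableD)
    also have "measure lebesgue (S \<inter> \<Union>D') \<le> (\<Sum>K\<in>D'. measure lebesgue (S \<inter> K))"
    proof -
      have "S \<inter> \<Union>D' = (\<Union>K\<in>D'. S \<inter> K)" by auto
      then show ?thesis
        using measure_UNION_le[OF D'(2), of "\<lambda>K. S \<inter> K" lebesgue] S Dm D'(1)
        by (auto simp: fmeasurableD subset_iff)
    qed
    also have "\<dots> \<le> (\<Sum>K\<in>D'. (1 - e) * measure lebesgue K)"
      using le D'(1) by (intro sum_mono) auto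
    also have "\<dots> = (1 - e) * measure lebesgue (\<Union>D')"
      using measure_negligible_finite_Union[OF D'(2) _ negl] Dm D'(1)
      by (auto simp: sum_distrib_left subset_iff)
    also have "\<dots> \<le> (1 - e) * (m + e')"
      using e D(7) measure_mono_fmeasurable[of "\<Union>D'" "\<Union>\<D>" lebesgue] D'(1) D'm D(6)
      by (intro mult_left_mono) (auto simp: fmeasurableD intro: order.trans)
    finally have "m \<le> (1 - e) * (m + e') + e'" using D'(3) by linarith
    also have "\<dots> = m * (1 - e + (1 - e) * (e / 4) + e / 4)"
      by (simp add: e'_def algebra_simps)
    also have "\<dots> < m * 1"
    proof (rule mult_strict_left_mono)
      have "e * e > 0" using e by simp
      then have "1 - e + (1 - e) * (e / 4) + e / 4 = 1 - e / 2 - e * e / 4" "e * e / 4 > 0"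
        by (simp_all add: field_simps)
      then show "1 - e + (1 - e) * (e / 4) + e / 4 < 1" using e by linarith
    qed (use pos m_def in auto)
    finally show False by simp
  qed
  then obtain K where K: "K \<in> \<D>" "measure lebesgue (S \<inter> K) > (1 - e) * measure lebesgue K" by blast
  with dy obtain u n where "K = {u..u + 1 / 2 ^ n}" by blast
  with K(2) show ?thesis by (intro that[of n u]) auto
qed

lemma measure_lebesgue_scale_real:
  fixes c :: real
  assumes "c > 0"
  shows "measure lebesgue ((*) c ` A) = c * measure lebesgue A"
  using measure_lebesgue_affine[of c 0 A] assms by (simp add: scaleR_conv_of_real cong: image_cong_simp)

lemma sets_lebesgue_scale_real:
  fixes c :: real
  assumes "c > 0" "A \<in> sets lebesgue"
  shows "(*) c ` A \<in> sets lebesgue"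
proof -
  have "(*) c ` A = (*\<^sub>R) (1 / c) -` A \<inter> space lebesgue"
    using assms(1) by (auto simp: image_iff intro!: bexI[of _ "_ / c"])
  then show ?thesis using measurable_sets[OF lebesgue_measurable_scaling assms(2)] by simp
qed

text \<open>Doubling a dyadic interval that is almost filled by \<open>W\<close> eventually yields an interval of length 1.\<close>

lemma zero_one_law_doubling:
  fixes W :: "real set"
  assumes W[measurable]: "W \<in> sets lebesgue"
    and trans: "\<And>x (k::int). x \<in> W \<Longrightarrow> x + k \<in> W"
    and dbl: "\<And>x. x \<in> W \<Longrightarrow> 2 * x \<in> W"
    and pos: "\<not> negligible W"
  shows "AE x in lebesgue. x \<in> W"
proof -
  have trans': "x + real_of_int k \<in> W \<longleftrightarrow> x \<in> W" for x k
    using trans[of x k] trans[of "x + k" "-k"] by auto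
  have pow: "2 ^ n * x \<in> W" if "x \<in> W" for n x
    using that dbl by (induction n) (auto simp: mult.assoc)
  \<comment> \<open>Integer translates of the part in \<open>{0..1}\<close> exhaust a 1-periodic
    set, so nullity can be tested on that part.\<close>
  have cover: "A \<subseteq> (\<Union>k::int. (+) (real_of_int k) ` (A \<inter> {0..1}))"
    if "\<And>x k. x \<in> A \<Longrightarrow> x + real_of_int k \<in> A" for A :: "real set"
  proof
    fix x assume "x \<in> A"
    then have "x + real_of_int (- \<lfloor>x\<rfloor>) \<in> A \<inter> {0..1}"
      using that[of x "- \<lfloor>x\<rfloor>"] by (auto, linarith+)
    then have "of_int \<lfloor>x\<rfloor> + (x + real_of_int (- \<lfloor>x\<rfloor>)) \<in> (+) (real_of_int \<lfloor>x\<rfloor>) ` (A \<inter> {0..1})"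
      by blast
    then show "x \<in> (\<Union>k::int. (+) (real_of_int k) ` (A \<inter> {0..1}))" by auto
  qed
  have negl_unit: "negligible A"
    if "\<And>x k. x \<in> A \<Longrightarrow> x + real_of_int k \<in> A" "negligible (A \<inter> {0..1})" for A :: "real set"
    by (rule negligible_subset[OF _ cover])
      (use that in \<open>auto intro!: negligible_countable_Union negligible_translation\<close>)
  have unit: "A \<inter> {a..b} \<in> lmeasurable" if "A \<in> sets lebesgue" for A :: "real set" and a b
    using that by (intro bounded_set_imp_lmeasurable) (auto intro: bounded_subset[of "{a..b}"])
  have "measure lebesgue (W \<inter> {0..1}) \<noteq> 0"
    using pos negl_unit[of W] trans unit[OF W] by (auto simp: negligible_iff_measure)
  then have pos1: "measure lebesgue (W \<inter> {0..1}) > 0"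
    using measure_nonneg[of lebesgue "W \<inter> {0..1}"] by linarith
  define V where "V = - W"
  have V[measurable]: "V \<in> sets lebesgue" unfolding V_def using W by (simp add: Compl_in_sets_lebesgue)
  have Vt: "x + real_of_int k \<in> V \<longleftrightarrow> x \<in> V" for x k
    using trans'[of x k] by (simp add: V_def)
  have small: "measure lebesgue (V \<inter> {0..1}) \<le> 2 * e" if e: "0 < e" "e < 1" for e
  proof -
    obtain u n where un: "measure lebesgue ((W \<inter> {0..1}) \<inter> {u..u + 1 / 2 ^ n}) > (1 - e) / 2 ^ n"
      by (rule exists_dyadic_interval_dense[OF unit[OF W] _ pos1 e]) auto
    define x where "x = 2 ^ n * u"
    have "(*) (2 ^ n) ` ((W \<inter> {0..1}) \<inter> {u..u + 1 / 2 ^ n}) \<subseteq> W \<inter> {x..x + 1}"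
      by (auto simp: x_def pow) (simp_all add: field_simps)
    then have "measure lebesgue ((*) (2 ^ n) ` ((W \<inter> {0..1}) \<inter> {u..u + 1 / 2 ^ n}))
        \<le> measure lebesgue (W \<inter> {x..x + 1})"
      by (intro measure_mono_fmeasurable unit W)
        (auto intro: sets_lebesgue_scale_real simp: fmeasurableD unit[OF W] sets.Int W)
    then have "1 - e < measure lebesgue (W \<inter> {x..x + 1})"
      unfolding measure_lebesgue_scale_real[of "2 ^ n", simplified]
      using un by (simp add: pos_divide_less_eq mult.commute)
    moreover have "V \<inter> {x..x + 1} = {x..x + 1} - W \<inter> {x..x + 1}" by (auto simp: V_def)
    then have "measure lebesgue (V \<inter> {x..x + 1}) = 1 - measure lebesgue (W \<inter> {x..x + 1})"
      using measurable_measure_Diff[of "{x..x + 1}" lebesgue "W \<inter> {x..x + 1}"] unit[OF W, of x "x+1"]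
      by (simp add: fmeasurableD)
    ultimately have Vx: "measure lebesgue (V \<inter> {x..x + 1}) \<le> e" by linarith
    \<comment> \<open>The unit interval from x to x + 1 need not start at an integer, so two
      translates of it are needed to cover \<open>{0..1}\<close>; this costs the factor 2 in
      \<open>2 * e\<close>.\<close>
    have sub: "V \<inter> {0..1} \<subseteq> (\<lambda>y. y - of_int \<lfloor>x\<rfloor>) ` (V \<inter> {x..x + 1}) \<union>
        (\<lambda>y. y - of_int (\<lfloor>x\<rfloor> + 1)) ` (V \<inter> {x..x + 1})"
    proof
      fix y assume y: "y \<in> V \<inter> {0..1}"
      show "y \<in> (\<lambda>y. y - of_int \<lfloor>x\<rfloor>) ` (V \<inter> {x..x + 1}) \<union>
        (\<lambda>y. y - of_int (\<lfloor>x\<rfloor> + 1)) ` (V \<inter> {x..x + 1})"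
      proof (cases "y + \<lfloor>x\<rfloor> \<ge> x")
        case True
        then have "y + \<lfloor>x\<rfloor> \<in> V \<inter> {x..x + 1}" using y Vt[of y "\<lfloor>x\<rfloor>"] by (auto, linarith)
        then show ?thesis by (intro UnI1) (auto simp: image_iff intro!: bexI[of _ "y + \<lfloor>x\<rfloor>"])
      next
        case False
        then have "y + of_int (\<lfloor>x\<rfloor> + 1) \<in> V \<inter> {x..x + 1}" using y Vt[of y "\<lfloor>x\<rfloor> + 1"] by (auto, linarith+)
        then show ?thesis by (intro UnI2) (auto simp: image_iff intro!: bexI[of _ "y + (\<lfloor>x\<rfloor> + 1)"])
      qed
    qed
    have tm: "(\<lambda>y. y - c) ` (V \<inter> {x..x + 1}) \<in> lmeasurable" for c
      by (intro measurable_translation_subtract unit V)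
    have "measure lebesgue (V \<inter> {0..1}) \<le> measure lebesgue ((\<lambda>y. y - of_int \<lfloor>x\<rfloor>) ` (V \<inter> {x..x + 1}))
       + measure lebesgue ((\<lambda>y. y - of_int (\<lfloor>x\<rfloor> + 1)) ` (V \<inter> {x..x + 1}))"
      by (rule order.trans[OF measure_mono_fmeasurable[OF sub] measure_Un_le])
        (use tm unit[OF V] in \<open>auto simp: fmeasurableD intro!: fmeasurable.Un\<close>)
    then show ?thesis using Vx by (simp only: measure_translation_subtract)
  qed
  have "measure lebesgue (V \<inter> {0..1}) \<le> 0 + d" if "d > 0" for d
    using small[of "d / 2"] small[of "1 / 2"] that by (cases "d \<le> 1") auto
  then have "measure lebesgue (V \<inter> {0..1}) \<le> 0" by (rule field_le_epsilon)
  then have "negligible (V \<inter> {0..1})"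
    using unit[OF V] measure_nonneg[of lebesgue "V \<inter> {0..1}"] by (auto simp: negligible_iff_measure)
  then have "negligible V" using negl_unit[of V] Vt by blast
  then show ?thesis
    by (intro AE_I'[of V]) (auto simp: negligible_iff_null_sets V_def)
qed

section \<open>Counting multiples close to a point\<close>

lemma int_dist_nonneg [simp]: "int_dist x \<ge> 0"
  by (simp add: int_dist_def infdist_nonneg)

lemma int_dist_le: "int_dist x \<le> \<bar>x - of_int k\<bar>"
  unfolding int_dist_def by (rule infdist_le2[of "of_int k"]) (auto simp: dist_real_def)

lemma obtain_int_dist: obtains k :: int where "int_dist x = \<bar>x - of_int k\<bar>"
  using int_dist_eq_round by blast

lemma int_dist_add_le: "int_dist (x + y) \<le> int_dist x + \<bar>y\<bar>"
proof -
  obtain k where "int_dist x = \<bar>x - of_int k\<bar>" by (rule obtain_int_dist)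
  then show ?thesis using int_dist_le[of "x + y" k] by linarith
qed

lemma int_dist_add_int [simp]: "int_dist (x + of_int k) = int_dist x"
proof (rule antisym)
  have le: "int_dist (x + of_int k) \<le> int_dist x" for x k
  proof -
    obtain m where "int_dist x = \<bar>x - of_int m\<bar>" by (rule obtain_int_dist)
    then show ?thesis using int_dist_le[of "x + of_int k" "m + k"] by auto
  qed
  show "int_dist (x + of_int k) \<le> int_dist x" by (rule le)
  show "int_dist x \<le> int_dist (x + of_int k)" using le[of "x + of_int k" "-k"] by simp
qed

lemma int_dist_mult_nat_le: "int_dist (real n * x) \<le> real n * int_dist x"
proof -
  obtain k where "int_dist x = \<bar>x - of_int k\<bar>" by (rule obtain_int_dist)
  moreover have "int_dist (real n * x) \<le> \<bar>real n * x - of_int (int n * k)\<bar>" by (rule int_dist_le)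
  moreover have "real n * x - of_int (int n * k) = real n * (x - of_int k)" by (simp add: algebra_simps)
  ultimately show ?thesis by (simp add: abs_mult)
qed

lemma int_dist_pos:
  assumes "x \<notin> \<rat>"
  shows "int_dist x > 0"
proof -
  obtain k where k: "int_dist x = \<bar>x - of_int k\<bar>" by (rule obtain_int_dist)
  have "x \<noteq> of_int k" using assms by auto
  then show ?thesis using k by simp
qed

lemma continuous_on_int_dist [continuous_intros]:
  "continuous_on A f \<Longrightarrow> continuous_on A (\<lambda>x. int_dist (f x))"
  unfolding int_dist_def by (intro continuous_intros)

text \<open>Over a block of \<open>q\<close> consecutive indices the points \<open>i * \<alpha> - \<gamma>\<close> run, up to an error \<open>2 / q\<close>,
  exactly once through the multiples of \<open>1 / q\<close> modulo 1.\<close>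

lemma block_residues:
  fixes \<alpha> \<gamma> :: real and q n\<^sub>0 :: nat and a :: int
  assumes q: "q > 0" and cop: "coprime a (int q)" and approx: "\<bar>real q * \<alpha> - a\<bar> \<le> 1 / q"
  obtains r where "bij_betw r {n\<^sub>0..<n\<^sub>0 + q} {0..<int q}"
    and "\<And>i x. i \<in> {n\<^sub>0..<n\<^sub>0 + q} \<Longrightarrow>
      \<bar>int_dist (real i * \<alpha> - \<gamma>) - int_dist (of_int (r i) / q)\<bar> \<le> 2 / q"
proof -
  \<comment> \<open>On the scale of 1 / q, rounding the starting point costs at most 1, and
    replacing \<open>q * \<alpha>\<close> by a over at most q steps costs at most 1 more.\<close>
  define c where "c = \<lfloor>real q * (n\<^sub>0 * \<alpha> - \<gamma>)\<rfloor>"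
  define s where "s i = c + (int i - int n\<^sub>0) * a" for i
  define r where "r i = s i mod int q" for i
  have "inj_on r {n\<^sub>0..<n\<^sub>0 + q}"
  proof (rule inj_onI)
    fix i j assume ij: "i \<in> {n\<^sub>0..<n\<^sub>0 + q}" "j \<in> {n\<^sub>0..<n\<^sub>0 + q}" "r i = r j"
    then have "[s i = s j] (mod int q)" by (simp add: r_def cong_def)
    then have "int q dvd (int i - int j) * a"
      by (simp add: s_def cong_iff_dvd_diff algebra_simps)
    then have "int q dvd int i - int j"
      using cop by (metis coprime_commute coprime_dvd_mult_left_iff)
    moreover have "\<bar>int i - int j\<bar> < int q" using ij by auto
    ultimately show "i = j" using zdvd_imp_le[of "int q" "\<bar>int i - int j\<bar>"] by force
  qed
  moreover have "r ` {n\<^sub>0..<n\<^sub>0 + q} \<subseteq> {0..<int q}" using q by (auto simp: r_def)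
  ultimately have "bij_betw r {n\<^sub>0..<n\<^sub>0 + q} {0..<int q}"
    by (intro bij_betw_imageI card_subset_eq) (auto simp: card_image)
  moreover have "\<bar>int_dist (real i * \<alpha> - \<gamma>) - int_dist (of_int (r i) / q)\<bar> \<le> 2 / q"
    if i: "i \<in> {n\<^sub>0..<n\<^sub>0 + q}" for i
  proof -
    define j where "j = real i - real n\<^sub>0"
    have j: "0 \<le> j" "j \<le> q" using i by (auto simp: j_def)
    have "of_int (s i) = of_int (r i) + real q * of_int (s i div int q)"
      unfolding r_def by (metis add.commute mult_div_mod_eq of_int_add of_int_mult of_int_of_nat_eq)
    then have "of_int (s i) / real q = of_int (r i) / q + of_int (s i div int q)"
      using q by (simp add: field_simps)
    then have sr: "int_dist (of_int (s i) / q) = int_dist (of_int (r i) / q)" by simp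
    define e where "e = (real i * \<alpha> - \<gamma>) - of_int (s i) / q"
    have si: "of_int (s i) = of_int c + j * of_int a" by (simp add: s_def j_def)
    have "real q * e = (real q * (n\<^sub>0 * \<alpha> - \<gamma>) - of_int c) + j * (real q * \<alpha> - a)"
      using q by (simp add: e_def si j_def field_simps)
    moreover have "\<bar>real q * (n\<^sub>0 * \<alpha> - \<gamma>) - of_int c\<bar> \<le> 1"
      unfolding c_def by linarith
    moreover have "\<bar>j * (real q * \<alpha> - a)\<bar> \<le> real q * (1 / q)"
      unfolding abs_mult using j approx by (intro mult_mono) auto
    ultimately have "\<bar>real q * e\<bar> \<le> 2" using q by simp
    then have e: "\<bar>e\<bar> \<le> 2 / q" using q by (simp add: abs_mult field_simps)
    have "int_dist (real i * \<alpha> - \<gamma>) \<le> int_dist (of_int (s i) / q) + \<bar>e\<bar>"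
      using int_dist_add_le[of "of_int (s i) / q" e] by (simp add: e_def)
    moreover have "int_dist (of_int (s i) / q) \<le> int_dist (real i * \<alpha> - \<gamma>) + \<bar>e\<bar>"
      using int_dist_add_le[of "real i * \<alpha> - \<gamma>" "-e"] by (simp add: e_def)
    ultimately show ?thesis using e sr by linarith
  qed
  ultimately show ?thesis using that by blast
qed

text \<open>By \<open>block_residues\<close>, only residues r with r / q within
  \<open>\<delta> + 2 / q\<close> of an integer matter. They lie within
  \<open>X = \<delta> * q + 2\<close> of 0 or of q, and \<open>2 * X + 1\<close> bounds their
  number.\<close>

lemma card_block_upper:
  fixes \<alpha> \<gamma> \<delta> :: real and q n\<^sub>0 :: nat and a :: int
  assumes q: "q > 0" and cop: "coprime a (int q)" and approx: "\<bar>real q * \<alpha> - a\<bar> \<le> 1 / q"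
    and \<delta>: "\<delta> \<ge> 0"
  shows "card {i \<in> {n\<^sub>0..<n\<^sub>0 + q}. int_dist (real i * \<alpha> - \<gamma>) \<le> \<delta>} \<le> 2 * \<delta> * q + 5"
proof -
  obtain r where bij: "bij_betw r {n\<^sub>0..<n\<^sub>0 + q} {0..<int q}"
    and r: "\<And>i. i \<in> {n\<^sub>0..<n\<^sub>0 + q} \<Longrightarrow>
      \<bar>int_dist (real i * \<alpha> - \<gamma>) - int_dist (of_int (r i) / q)\<bar> \<le> 2 / q"
    using block_residues[OF q cop approx, of n\<^sub>0 \<gamma>] by metis
  define X where "X = \<delta> * q + 2"
  define M where "M = \<lfloor>X\<rfloor>"
  have X: "X \<ge> 0" using \<delta> by (simp add: X_def)
  let ?A = "{i \<in> {n\<^sub>0..<n\<^sub>0 + q}. int_dist (real i * \<alpha> - \<gamma>) \<le> \<delta>}"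
  have "r ` ?A \<subseteq> {0..M} \<union> {int q - M..<int q}"
  proof (rule image_subsetI)
    fix i assume i: "i \<in> ?A"
    then have ri: "r i \<in> {0..<int q}" using bij by (auto simp: bij_betw_def)
    obtain k where k: "int_dist (of_int (r i) / q) = \<bar>of_int (r i) / q - of_int k\<bar>"
      by (rule obtain_int_dist)
    have "\<bar>of_int (r i) / q - of_int k\<bar> \<le> \<delta> + 2 / q" using r[of i] i k by auto
    then have "\<bar>of_int (r i) / q - of_int k\<bar> * q \<le> X"
      using q by (simp add: X_def field_simps)
    then have "\<bar>(of_int (r i) / q - of_int k) * q\<bar> \<le> X" by (simp add: abs_mult)
    then have "\<bar>of_int (r i - k * int q)\<bar> \<le> X" using q by (simp add: algebra_simps)
    then have le: "\<bar>r i - k * int q\<bar> \<le> M" unfolding M_def by linarith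
    show "r i \<in> {0..M} \<union> {int q - M..<int q}"
    proof (cases "k \<le> 0")
      case True
      then have "k * int q \<le> 0" by (simp add: mult_nonpos_nonneg)
      then show ?thesis using le ri by auto
    next
      case False
      then have "k * int q \<ge> int q" using q by simp
      then have "int q - M \<le> r i" using le by linarith
      then show ?thesis using ri by auto
    qed
  qed
  then have "card (r ` ?A) \<le> card ({0..M} \<union> {int q - M..<int q})"
    by (intro card_mono) auto
  also have "\<dots> \<le> card {0..M} + card {int q - M..<int q}" by (rule card_Un_le)
  finally have "card (r ` ?A) \<le> nat (M + 1) + nat M" by simp
  moreover have "card (r ` ?A) = card ?A"
    by (intro card_image inj_on_subset[OF bij_betw_imp_inj_on[OF bij]]) auto
  moreover have "M \<ge> 0" using X by (simp add: M_def)
  ultimately have "real (card ?A) \<le> 2 * M + 1" by linarith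
  also have "\<dots> \<le> 2 * X + 1" by (simp add: M_def)
  finally show ?thesis by (simp add: X_def)
qed

text \<open>The residues from 0 up to \<open>\<delta> * q - 2\<close> already suffice; those just
  below q are discarded. The hypothesis \<open>\<delta> \<le> 1\<close> keeps the chosen residues
  below q.\<close>

lemma card_block_lower:
  fixes \<alpha> \<gamma> \<delta> :: real and q n\<^sub>0 :: nat and a :: int
  assumes q: "q > 0" and cop: "coprime a (int q)" and approx: "\<bar>real q * \<alpha> - a\<bar> \<le> 1 / q"
    and \<delta>: "\<delta> \<le> 1"
  shows "\<delta> * q - 2 \<le> card {i \<in> {n\<^sub>0..<n\<^sub>0 + q}. int_dist (real i * \<alpha> - \<gamma>) \<le> \<delta>}"
proof -
  obtain r where bij: "bij_betw r {n\<^sub>0..<n\<^sub>0 + q} {0..<int q}"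
    and r: "\<And>i. i \<in> {n\<^sub>0..<n\<^sub>0 + q} \<Longrightarrow>
      \<bar>int_dist (real i * \<alpha> - \<gamma>) - int_dist (of_int (r i) / q)\<bar> \<le> 2 / q"
    using block_residues[OF q cop approx, of n\<^sub>0 \<gamma>] by metis
  define X where "X = \<delta> * q - 2"
  define M where "M = \<lfloor>X\<rfloor>"
  let ?A = "{i \<in> {n\<^sub>0..<n\<^sub>0 + q}. int_dist (real i * \<alpha> - \<gamma>) \<le> \<delta>}"
  have "\<delta> * real q \<le> 1 * real q" using \<delta> by (intro mult_right_mono) auto
  then have Mq: "M < int q" unfolding M_def X_def using q by linarith
  have "{0..M} \<subseteq> r ` ?A"
  proof
    fix m assume m: "m \<in> {0..M}"
    then have "m \<in> r ` {n\<^sub>0..<n\<^sub>0 + q}"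
      unfolding bij_betw_imp_surj_on[OF bij] using Mq by simp
    then obtain i where i: "i \<in> {n\<^sub>0..<n\<^sub>0 + q}" "r i = m" by blast
    have "of_int m \<le> X" using m by (simp add: M_def le_floor_iff)
    then have "of_int m / q + 2 / q \<le> \<delta>" using q by (simp add: X_def field_simps)
    moreover have "int_dist (of_int m / q) \<le> of_int m / q"
      using int_dist_le[of "of_int m / q" 0] m by simp
    ultimately have "int_dist (real i * \<alpha> - \<gamma>) \<le> \<delta>" using r[OF i(1), unfolded i(2)] by linarith
    then show "m \<in> r ` ?A" using i by auto
  qed
  then have "card {0..M} \<le> card (r ` ?A)" by (intro card_mono) auto
  also have "\<dots> \<le> card ?A" by (rule card_image_le) auto
  finally have "real (nat (M + 1)) \<le> card ?A" by simp
  moreover have "X \<le> real (nat (M + 1))" unfolding M_def by linarith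
  ultimately show ?thesis by (simp add: X_def)
qed

lemma card_filter_atLeastLessThan_add:
  fixes n m q :: nat
  assumes "n \<le> m"
  shows "card {i \<in> {n..<m + q}. P i} = card {i \<in> {n..<m}. P i} + card {i \<in> {m..<m + q}. P i}"
proof -
  have "{i \<in> {n..<m + q}. P i} = {i \<in> {n..<m}. P i} \<union> {i \<in> {m..<m + q}. P i}"
    using assms by auto
  moreover have "{i \<in> {n..<m}. P i} \<inter> {i \<in> {m..<m + q}. P i} = {}" by auto
  ultimately show ?thesis by (simp add: card_Un_disjoint)
qed

lemma card_blocks_Suc:
  fixes n b q :: nat
  shows "card {i \<in> {n..<n + Suc b * q}. P i} =
    card {i \<in> {n..<n + b * q}. P i} + card {i \<in> {n + b * q..<n + b * q + q}. P i}"
proof -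
  have "n + Suc b * q = n + b * q + q" by simp
  then show ?thesis by (simp only: card_filter_atLeastLessThan_add[OF le_add1])
qed

lemma card_blocks_le:
  fixes c :: real and b q :: nat
  assumes "\<And>n. card {i \<in> {n..<n + q}. P i} \<le> c"
  shows "card {i \<in> {n..<n + b * q}. P i} \<le> b * c"
proof (induction b)
  case (Suc b)
  have eq: "real (Suc b) * c = real b * c + c" by (simp add: algebra_simps)
  show ?case unfolding card_blocks_Suc[of n b q P] of_nat_add eq by (rule add_mono[OF Suc assms])
qed simp

lemma card_blocks_ge:
  fixes c :: real and b q :: nat
  assumes "\<And>n. c \<le> card {i \<in> {n..<n + q}. P i}"
  shows "b * c \<le> card {i \<in> {n..<n + b * q}. P i}"
proof (induction b)
  case (Suc b)
  have eq: "real (Suc b) * c = real b * c + c" by (simp add: algebra_simps)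
  show ?case unfolding card_blocks_Suc[of n b q P] of_nat_add eq by (rule add_mono[OF Suc assms])
qed simp

section \<open>Reciprocal squares and a lower bound for the totient\<close>

lemma sum_inverse_squares_le:
  fixes a M :: nat
  assumes "a > 0" "a \<le> M"
  shows "(\<Sum>d\<in>{a<..M}. 1 / (real d)\<^sup>2) \<le> 1 / a - 1 / M"
  using assms(2)
proof (induction M rule: dec_induct)
  case (step M)
  have "{a<..Suc M} = insert (Suc M) {a<..M}" using step by auto
  moreover have "1 / (real (Suc M))\<^sup>2 \<le> 1 / M - 1 / Suc M"
  proof -
    have "M > 0" using assms(1) step(1) by simp
    then have "1 / (real M * real (Suc M)) = 1 / M - 1 / Suc M" by (simp add: field_simps)
    moreover have "1 / (real (Suc M) * real (Suc M)) \<le> 1 / (real M * real (Suc M))"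
      using \<open>M > 0\<close> by (intro divide_left_mono mult_right_mono mult_pos_pos) auto
    ultimately show ?thesis by (simp only: power2_eq_square)
  qed
  ultimately show ?case using step by auto
qed simp

text \<open>Euler's product combined with \<open>1 - x \<ge> exp (- 2 * x)\<close> for x between 0
  and 1 / 2. The exponent is a sum over prime divisors, which can be averaged over n by counting
  multiples.\<close>

lemma totient_ge_exp:
  "real n * exp (- 2 * (\<Sum>p\<in>prime_factors n. 1 / real p)) \<le> real (totient n)"
proof -
  have "(\<Prod>p\<in>prime_factors n. exp (- 2 * (1 / real p))) \<le> (\<Prod>p\<in>prime_factors n. 1 - 1 / real p)"
  proof (rule prod_mono)
    fix p assume "p \<in> prime_factors n"
    then have "p \<ge> 2" by (auto dest!: in_prime_factors_imp_prime simp: prime_ge_2_nat)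
    define x where "x = 1 / real p"
    have x: "0 < x" "x \<le> 1 / 2" using \<open>p \<ge> 2\<close> by (auto simp: x_def field_simps)
    have "x * (2 * x) \<le> x * 1" using x by (intro mult_left_mono) auto
    then have "1 \<le> (1 - x) * (1 + 2 * x)" by (simp add: algebra_simps)
    also have "\<dots> \<le> (1 - x) * exp (2 * x)"
      using x by (intro mult_left_mono exp_ge_add_one_self) auto
    finally have "exp (- 2 * x) \<le> 1 - x" by (simp add: exp_minus field_simps)
    then show "0 \<le> exp (- 2 * (1 / real p)) \<and> exp (- 2 * (1 / real p)) \<le> 1 - 1 / real p"
      by (simp add: x_def)
  qed
  then have "real n * (\<Prod>p\<in>prime_factors n. exp (- 2 * (1 / real p))) \<le> real (totient n)"
    unfolding totient_formula2 by (intro mult_left_mono) auto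
  then show ?thesis by (simp add: exp_sum sum_distrib_left)
qed

section \<open>Bohr sets of a Diophantine number\<close>

text \<open>A quantitative form of being irrational and not Liouville: one constant for all positive
  n, and a natural exponent so that ordinary powers can be used.\<close>

locale diophantine =
  fixes \<alpha> c :: real and w :: nat
  assumes c_pos: "c > 0"
    and c_le: "n > 0 \<Longrightarrow> c \<le> real n ^ w * int_dist (real n * \<alpha>)"
begin

text \<open>The factor \<open>16 ^ w\<close> absorbs the bound \<open>(q * d) ^ w\<close> in the Diophantine condition when
  \<open>q \<le> 8 * 4 ^ t\<close> and \<open>d \<le> 4 ^ t\<close>; the factor 8 leaves a margin that grows with \<open>t\<close>.\<close>

definition B :: nat where "B = 8 * 16 ^ w"

lemma B_ge: "B \<ge> 8"
  by (simp add: B_def)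

lemma four_power_le_B_power: "4 ^ t \<le> B ^ t"
  using B_ge by (intro power_mono) auto

text \<open>Dirichlet's theorem for \<open>d * \<alpha>\<close> supplies q with
  \<open>d * q \<le> B ^ t\<close>. A small q would bring \<open>q * d * \<alpha>\<close> closer to
  an integer than \<open>c_le\<close> allows. The bound \<open>8 * 4 ^ t\<close> is chosen so that
  \<open>\<delta> * q \<ge> 8\<close> as soon as \<open>\<delta> * 4 ^ t \<ge> 1\<close>.\<close>

lemma exists_large_denominator:
  "\<exists>t\<^sub>0. \<forall>t\<ge>t\<^sub>0. \<forall>d\<in>{1..4 ^ t}. \<exists>q a. coprime a (int q) \<and> 8 * 4 ^ t \<le> q \<and> d * q \<le> B ^ t \<and>
     \<bar>real q * (real d * \<alpha>) - of_int a\<bar> \<le> 1 / q"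
proof -
  \<comment> \<open>A small q would force
    \<open>B ^ t * c \<le> 4 ^ t * (16 ^ w) ^ t * (2 * 8 ^ w)\<close>; the spare factor
    \<open>2 ^ t\<close> contained in \<open>B ^ t\<close> must exceed what remains.\<close>
  obtain t\<^sub>0 where t0: "2 * 8 ^ w / c < 2 ^ t\<^sub>0"
    using real_arch_pow[of 2 "2 * 8 ^ w / c"] by auto
  show ?thesis
  proof (rule exI[of _ t\<^sub>0], intro allI impI ballI)
    fix t d :: nat assume t: "t\<^sub>0 \<le> t" and d: "d \<in> {1..4 ^ t}"
    define N where "N = B ^ t"
    define N' where "N' = N div d"
    have "d \<le> N" using d four_power_le_B_power[of t] by (auto simp: N_def)
    then have N': "N' > 0" using d by (simp add: N'_def div_greater_zero_iff)
    obtain h k where hk: "coprime h k" "0 < k" "k \<le> int N'" "\<bar>of_int k * (real d * \<alpha>) - of_int h\<bar> < 1 / N'"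
      by (rule Dirichlet_approx_coprime[OF N'])
    define q where "q = nat k"
    have q: "k = int q" "q > 0" "q \<le> N'" using hk by (auto simp: q_def)
    have approx: "\<bar>real q * (real d * \<alpha>) - of_int h\<bar> < 1 / N'" using hk(4) q(1) by simp
    have dq: "d * q \<le> N" using q(3) d by (auto simp: N'_def less_eq_div_iff_mult_less_eq mult.commute)
    have "8 * 4 ^ t \<le> q"
    proof (rule ccontr)
      assume "\<not> 8 * 4 ^ t \<le> q"
      then have "q \<le> 8 * 4 ^ t" by simp
      then have "q * d \<le> (8 * 4 ^ t) * 4 ^ t" using d by (intro mult_mono) auto
      also have "\<dots> = 8 * 16 ^ t" by (simp flip: power_mult_distrib)
      finally have qd: "real (q * d) \<le> 8 * 16 ^ t"
        by (metis of_nat_le_iff of_nat_mult of_nat_numeral of_nat_power)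
      have d4: "real d \<le> 4 ^ t"
        using d by (metis atLeastAtMost_iff of_nat_le_iff of_nat_numeral of_nat_power)
      \<comment> \<open>As \<open>N'\<close> is at least 1, rounding down in \<open>N div d\<close>
        loses at most a factor 2.\<close>
      have "N < d * (N' + 1)"
        using d dividend_less_times_div[of d N] by (simp add: N'_def)
      also have "\<dots> \<le> d * (2 * N')" using N' by (intro mult_left_mono) auto
      finally have "real N \<le> real (d * (2 * N'))" by linarith
      then have N: "real N \<le> 2 * real d * real N'" by simp
      have "real N * c \<le> (2 * real d * real N') * (real (q * d) ^ w * int_dist (real (q * d) * \<alpha>))"
        using N c_le[of "q * d"] q(2) d c_pos by (intro mult_mono) auto
      also have "\<dots> \<le> (2 * real d * real N') * (real (q * d) ^ w * (1 / N'))"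
        using int_dist_le[of "real (q * d) * \<alpha>" h] approx
        by (intro mult_left_mono) (auto simp: mult.assoc)
      also have "\<dots> = 2 * real d * real (q * d) ^ w" using N' by simp
      also have "\<dots> \<le> 2 * 4 ^ t * (8 * 16 ^ t) ^ w"
        using d4 qd by (intro mult_mono power_mono) auto
      also have "(8 * 16 ^ t) ^ w = 8 ^ w * ((16 ^ w) ^ t :: real)"
        unfolding power_mult_distrib power_mult[symmetric] mult.commute[of t w] ..
      finally have "real N * c \<le> (4 ^ t * (16 ^ w) ^ t) * (2 * 8 ^ w)" by (simp add: mult_ac)
      moreover have "(8::real) ^ t = 2 ^ t * 4 ^ t" by (simp flip: power_mult_distrib)
      then have "real N = 2 ^ t * (4 ^ t * (16 ^ w) ^ t)"
        by (simp add: N_def B_def power_mult_distrib)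
      ultimately have "(4 ^ t * (16 ^ w) ^ t) * (2 ^ t * c) \<le> (4 ^ t * (16 ^ w) ^ t) * (2 * 8 ^ w :: real)"
        by (simp add: mult_ac)
      then have "2 ^ t * c \<le> 2 * 8 ^ w" by (subst (asm) mult_le_cancel_left_pos) auto
      then have "2 ^ t \<le> 2 * 8 ^ w / c" using c_pos by (simp add: field_simps)
      moreover have "(2::real) ^ t\<^sub>0 \<le> 2 ^ t" using t by simp
      ultimately show False using t0 by linarith
    qed
    moreover have "1 / real N' \<le> 1 / q" using q by (simp add: frac_le)
    ultimately show "\<exists>q a. coprime a (int q) \<and> 8 * 4 ^ t \<le> q \<and> d * q \<le> B ^ t \<and>
        \<bar>real q * (real d * \<alpha>) - of_int a\<bar> \<le> 1 / q"
      using hk(1) q(1) dq approx unfolding N_def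
      by (intro exI[of _ q] exI[of _ h]) auto
  qed
qed

text \<open>One threshold, independent of \<open>\<gamma>\<close> and of the width
  \<open>\<delta>\<close>, shared by all lemmas that need a large denominator.\<close>

definition t\<^sub>0 :: nat where
  "t\<^sub>0 = (SOME t\<^sub>0. \<forall>t\<ge>t\<^sub>0. \<forall>d\<in>{1..4 ^ t}. \<exists>q a. coprime a (int q) \<and> 8 * 4 ^ t \<le> q \<and> d * q \<le> B ^ t \<and>
     \<bar>real q * (real d * \<alpha>) - of_int a\<bar> \<le> 1 / q)"

lemma obtain_large_denominator:
  assumes "t \<ge> t\<^sub>0" "1 \<le> d" "d \<le> 4 ^ t"
  obtains q a where "coprime a (int q)" "8 * 4 ^ t \<le> q" "d * q \<le> B ^ t"
    "\<bar>real q * (real d * \<alpha>) - of_int a\<bar> \<le> 1 / q"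
  using someI_ex[OF exists_large_denominator] assms unfolding t\<^sub>0_def[symmetric]
  by (metis atLeastAtMost_iff)

definition Bohr :: "real \<Rightarrow> real \<Rightarrow> nat \<Rightarrow> nat set" where
  "Bohr \<gamma> \<delta> t = {n \<in> {B ^ t..<2 * B ^ t}. int_dist (real n * \<alpha> - \<gamma>) \<le> \<delta>}"

lemma finite_Bohr [simp]: "finite (Bohr \<gamma> \<delta> t)"
  by (simp add: Bohr_def)

text \<open>The full blocks of length q that fit into the range cover at least half of it, and each
  contributes at least \<open>\<delta> * q - 2 \<ge> \<delta> * q / 2\<close> elements; the two
  halves give the 4.\<close>

lemma card_Bohr_ge:
  fixes \<gamma> \<delta> :: real and t :: nat
  assumes t: "t \<ge> t\<^sub>0" and \<delta>: "1 \<le> \<delta> * 4 ^ t" "\<delta> \<le> 1"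
  shows "\<delta> * B ^ t / 4 \<le> card (Bohr \<gamma> \<delta> t)"
proof -
  define N where "N = B ^ t"
  obtain q a where q: "coprime a (int q)" "8 * 4 ^ t \<le> q" "1 * q \<le> N"
    "\<bar>real q * (real 1 * \<alpha>) - of_int a\<bar> \<le> 1 / q"
    by (rule obtain_large_denominator[OF t, of 1]) (auto simp: N_def)
  have "q > 0" using q(2) by (metis gr0I mult_eq_0_iff not_le power_not_zero zero_neq_numeral le_zero_eq)
  have "\<delta> > 0" using \<delta>(1) by (metis mult_nonpos_nonneg not_le order.trans zero_le_numeral zero_le_power zero_less_one)
  have "real (8 * 4 ^ t) \<le> q" using q(2) of_nat_le_iff by blast
  then have "\<delta> * (8 * 4 ^ t) \<le> \<delta> * q" using \<open>\<delta> > 0\<close> by (intro mult_left_mono) auto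
  then have \<delta>q: "8 \<le> \<delta> * q" using \<delta>(1) by linarith
  define b where "b = N div q"
  have "b \<ge> 1" using q(3) \<open>q > 0\<close> by (simp add: b_def Suc_le_eq div_greater_zero_iff)
  have "N < q * (b + 1)" using dividend_less_times_div[OF \<open>q > 0\<close>, of N] by (simp add: b_def)
  also have "\<dots> \<le> q * (2 * b)" using \<open>b \<ge> 1\<close> by (intro mult_left_mono) auto
  finally have "real N \<le> real (q * (2 * b))" by linarith
  then have Nb: "real N \<le> 2 * (b * q)" by (simp add: mult_ac)
  have "b * q \<le> N" by (simp add: b_def)
  have "\<delta> * N / 4 \<le> \<delta> * (2 * (b * q)) / 4" using Nb \<open>\<delta> > 0\<close> by simp
  also have "\<dots> = b * (\<delta> * q / 2)" by simp
  also have "\<dots> \<le> b * (\<delta> * q - 2)" using \<delta>q by (intro mult_left_mono) auto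
  also have "\<dots> \<le> card {n \<in> {N..<N + b * q}. int_dist (real n * \<alpha> - \<gamma>) \<le> \<delta>}"
    by (rule card_blocks_ge, rule card_block_lower[OF \<open>q > 0\<close> q(1) _ \<delta>(2)]) (use q(4) in simp)
  also have "\<dots> \<le> card (Bohr \<gamma> \<delta> t)"
    unfolding of_nat_le_iff Bohr_def using \<open>b * q \<le> N\<close>
    by (intro card_mono) (auto simp: N_def)
  finally show ?thesis by (simp add: N_def)
qed

text \<open>Writing \<open>n = d * m\<close> turns the count into a block count for
  \<open>d * \<alpha>\<close>, with its own denominator q. Each block holds at most
  \<open>2 * \<delta> * q + 5 \<le> 3 * \<delta> * q\<close> values m, and the blocks have total
  length at most \<open>4 * M\<close>, whence \<open>12 = 3 * 4\<close>.\<close>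

lemma card_Bohr_multiples_le:
  fixes \<gamma> \<delta> :: real and t d :: nat
  assumes t: "t \<ge> t\<^sub>0" and \<delta>: "1 \<le> \<delta> * 4 ^ t" and d: "1 \<le> d" "d \<le> 4 ^ t"
  shows "d * card {n \<in> Bohr \<gamma> \<delta> t. d dvd n} \<le> 12 * \<delta> * B ^ t"
proof -
  define N where "N = B ^ t"
  obtain q a where q: "coprime a (int q)" "8 * 4 ^ t \<le> q" "d * q \<le> N"
    "\<bar>real q * (real d * \<alpha>) - of_int a\<bar> \<le> 1 / q"
    by (rule obtain_large_denominator[OF t d]) (auto simp: N_def)
  have "8 * 4 ^ t \<ge> (8::nat)" by simp
  then have "q \<ge> 8" using q(2) by linarith
  have "\<delta> > 0" using \<delta>(1) by (metis mult_nonpos_nonneg not_le order.trans zero_le_numeral zero_le_power zero_less_one)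
  have "real (8 * 4 ^ t) \<le> q" using q(2) of_nat_le_iff by blast
  then have "\<delta> * (8 * 4 ^ t) \<le> \<delta> * q" using \<open>\<delta> > 0\<close> by (intro mult_left_mono) auto
  then have \<delta>q: "8 \<le> \<delta> * q" using \<delta>(1) by linarith
  define M where "M = N div d"
  have "q \<le> M" using q(3) d by (auto simp: M_def less_eq_div_iff_mult_less_eq mult.commute)
  \<comment> \<open>Rounding in \<open>M = N div d\<close> means that m runs from M to at most
    \<open>2 * M + 1\<close>, so the blocks must cover \<open>M + 2\<close> indices.\<close>
  define b where "b = (M + 2) div q + 1"
  have b1: "M + 2 \<le> b * q"
    using dividend_less_times_div[of q "M + 2"] \<open>q \<ge> 8\<close> by (simp add: b_def algebra_simps)
  have "b * q \<le> M + 2 + q" by (simp add: b_def)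
  then have "b * q \<le> 4 * M" using \<open>q \<le> M\<close> \<open>q \<ge> 8\<close> by linarith
  moreover have "d * M \<le> N" by (simp add: M_def)
  ultimately have "d * (b * q) \<le> 4 * N"
    using mult_le_mono2[of "b * q" "4 * M" d] mult.left_commute[of d 4 M] by linarith
  then have dbq: "real d * (real b * real q) \<le> 4 * N"
    by (metis of_nat_le_iff of_nat_mult of_nat_numeral)
  have "{n \<in> Bohr \<gamma> \<delta> t. d dvd n} \<subseteq>
      (*) d ` {m \<in> {M..<M + b * q}. int_dist (real m * (real d * \<alpha>) - \<gamma>) \<le> \<delta>}"
  proof
    fix n assume n: "n \<in> {n \<in> Bohr \<gamma> \<delta> t. d dvd n}"
    then obtain m where m: "n = d * m" by auto
    have "M \<le> m" using n d div_le_mono[of N n d] by (auto simp: M_def m Bohr_def N_def)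
    have "N < d * (M + 1)" using d dividend_less_times_div[of d N] by (simp add: M_def)
    moreover have "d * m < 2 * N" using n m by (auto simp: Bohr_def N_def)
    ultimately have "d * m < d * (2 * (M + 1))" by simp
    then have "m < 2 * (M + 1)" by (simp only: mult_less_cancel1)
    also have "2 * (M + 1) = M + (M + 2)" by simp
    also have "\<dots> \<le> M + b * q" using b1 by (rule add_left_mono)
    finally have "m < M + b * q" .
    moreover have "int_dist (real m * (real d * \<alpha>) - \<gamma>) \<le> \<delta>"
    proof -
      have eq: "real m * (real d * \<alpha>) = real n * \<alpha>" by (simp add: m)
      show ?thesis unfolding eq using n by (simp add: Bohr_def)
    qed
    ultimately show "n \<in> (*) d ` {m \<in> {M..<M + b * q}. int_dist (real m * (real d * \<alpha>) - \<gamma>) \<le> \<delta>}"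
      unfolding m using \<open>M \<le> m\<close> by (intro imageI CollectI conjI) (auto simp del: of_nat_mult)
  qed
  then have "card {n \<in> Bohr \<gamma> \<delta> t. d dvd n} \<le>
      card {m \<in> {M..<M + b * q}. int_dist (real m * (real d * \<alpha>) - \<gamma>) \<le> \<delta>}"
    by (intro surj_card_le) auto
  then have "real (card {n \<in> Bohr \<gamma> \<delta> t. d dvd n}) \<le>
      real (card {m \<in> {M..<M + b * q}. int_dist (real m * (real d * \<alpha>) - \<gamma>) \<le> \<delta>})"
    by simp
  also have "\<dots> \<le> b * (2 * \<delta> * q + 5)"
    by (rule card_blocks_le, rule card_block_upper) (use q \<open>q \<ge> 8\<close> \<open>\<delta> > 0\<close> in auto)
  also have "\<dots> \<le> b * (3 * \<delta> * q)" using \<delta>q by (intro mult_left_mono) auto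
  finally have "d * real (card {n \<in> Bohr \<gamma> \<delta> t. d dvd n}) \<le> d * (b * (3 * \<delta> * q))"
    by (intro mult_left_mono) auto
  also have "\<dots> = 3 * \<delta> * (real d * (real b * real q))" by simp
  also have "\<dots> \<le> 3 * \<delta> * (4 * N)" using dbq \<open>\<delta> > 0\<close> by (intro mult_left_mono) auto
  finally show ?thesis by (simp add: N_def)
qed

text \<open>The trivial bound that forgets the Bohr condition; it serves for d beyond
  \<open>4 ^ t\<close>, where \<open>card_Bohr_multiples_le\<close> does not apply.\<close>

lemma card_multiples_le:
  fixes \<gamma> \<delta> :: real and t d :: nat
  assumes "d > 0"
  shows "d * card {n \<in> Bohr \<gamma> \<delta> t. d dvd n} \<le> 2 * B ^ t"
proof -
  define N where "N = B ^ t"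
  have "N > 0" using B_ge by (simp add: N_def)
  have "{n \<in> Bohr \<gamma> \<delta> t. d dvd n} \<subseteq> (*) d ` {1..2 * N div d}"
  proof
    fix n assume n: "n \<in> {n \<in> Bohr \<gamma> \<delta> t. d dvd n}"
    then obtain m where m: "n = d * m" by auto
    have "N \<le> d * m" "d * m \<le> 2 * N" using n m by (auto simp: Bohr_def N_def)
    then have "m \<in> {1..2 * N div d}"
      using \<open>N > 0\<close> assms by (auto simp: less_eq_div_iff_mult_less_eq mult.commute Suc_le_eq intro: Nat.gr0I)
    then show "n \<in> (*) d ` {1..2 * N div d}" using m by blast
  qed
  then have "card {n \<in> Bohr \<gamma> \<delta> t. d dvd n} \<le> card {1..2 * N div d}"
    by (intro surj_card_le) auto
  then have "d * card {n \<in> Bohr \<gamma> \<delta> t. d dvd n} \<le> d * (2 * N div d)" by simp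
  also have "\<dots> \<le> 2 * N" by simp
  finally show ?thesis by (simp add: N_def)
qed

text \<open>Primes are relaxed to all divisors d > 1 and the sums are interchanged; one factor 1 / d
  comes from the summand and one from counting multiples, so the sum over d converges. Divisors up
  to \<open>4 ^ t\<close> contribute \<open>12 * \<delta> * N\<close>, and the tail contributes
  \<open>2 * N / 4 ^ t \<le> 2 * \<delta> * N\<close>.\<close>

lemma sum_prime_factors_Bohr_le:
  fixes \<gamma> \<delta> :: real and t :: nat
  assumes t: "t \<ge> t\<^sub>0" and \<delta>: "1 \<le> \<delta> * 4 ^ t"
  shows "(\<Sum>n\<in>Bohr \<gamma> \<delta> t. \<Sum>p\<in>prime_factors n. 1 / real p) \<le> 14 * \<delta> * B ^ t"
proof -
  define N where "N = B ^ t"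
  define A where "A = Bohr \<gamma> \<delta> t"
  define D :: nat where "D = 4 ^ t"
  have "N > 0" "D > 0" "D \<le> N" using B_ge four_power_le_B_power[of t] by (auto simp: N_def D_def)
  have "\<delta> > 0" using \<delta>(1) by (metis mult_nonpos_nonneg not_le order.trans zero_le_numeral zero_le_power zero_less_one)
  have A: "finite A" "\<And>n. n \<in> A \<Longrightarrow> 0 < n \<and> n \<le> 2 * N"
    using \<open>N > 0\<close> by (auto simp: A_def Bohr_def N_def)
  have "(\<Sum>n\<in>A. \<Sum>p\<in>prime_factors n. 1 / real p) \<le> (\<Sum>n\<in>A. \<Sum>d\<in>{d\<in>{1<..2 * N}. d dvd n}. 1 / real d)"
  proof (intro sum_mono sum_mono2)
    fix n assume n: "n \<in> A"
    show "prime_factors n \<subseteq> {d \<in> {1<..2 * N}. d dvd n}"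
    proof
      fix p assume p: "p \<in> prime_factors n"
      then have "prime p" "p dvd n" by auto
      then show "p \<in> {d \<in> {1<..2 * N}. d dvd n}"
        using A(2)[OF n] dvd_imp_le[of p n] prime_gt_1_nat[of p] by auto
    qed
  qed auto
  also have "\<dots> = (\<Sum>d\<in>{1<..2 * N}. \<Sum>n\<in>{n\<in>A. d dvd n}. 1 / real d)"
    by (rule sum.swap_restrict) (use A in auto)
  also have "\<dots> = (\<Sum>d\<in>{1<..2 * N}. card {n\<in>A. d dvd n} / real d)" by simp
  also have "\<dots> \<le> (\<Sum>d\<in>{1<..2 * N}. 12 * \<delta> * N * (1 / (real d)\<^sup>2) +
      (if d \<in> {D<..2 * N} then 2 * real N * (1 / (real d)\<^sup>2) else 0))"
  proof (rule sum_mono)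
    fix d assume d: "d \<in> {1<..2 * N}"
    then have "real d > 0" by auto
    then have eq: "card {n\<in>A. d dvd n} / real d = real (d * card {n\<in>A. d dvd n}) * (1 / (real d)\<^sup>2)"
      by (simp add: power2_eq_square)
    show "card {n\<in>A. d dvd n} / real d \<le> 12 * \<delta> * N * (1 / (real d)\<^sup>2) +
      (if d \<in> {D<..2 * N} then 2 * real N * (1 / (real d)\<^sup>2) else 0)"
    proof (cases "d \<le> D")
      case True
      then have "real (d * card {n\<in>A. d dvd n}) \<le> 12 * \<delta> * N"
        using card_Bohr_multiples_le[OF t \<delta>, of d \<gamma>] d by (simp add: D_def A_def N_def)
      then have "real (d * card {n\<in>A. d dvd n}) * (1 / (real d)\<^sup>2) \<le> 12 * \<delta> * N * (1 / (real d)\<^sup>2)"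
        by (intro mult_right_mono) auto
      then show ?thesis using True unfolding eq by auto
    next
      case False
      have "d * card {n\<in>A. d dvd n} \<le> 2 * N"
        using card_multiples_le[of d \<gamma> \<delta> t] d by (simp add: A_def N_def)
      then have "real (d * card {n\<in>A. d dvd n}) \<le> 2 * real N"
        by (metis of_nat_le_iff of_nat_mult of_nat_numeral)
      then have "real (d * card {n\<in>A. d dvd n}) * (1 / (real d)\<^sup>2) \<le> 2 * real N * (1 / (real d)\<^sup>2)"
        by (intro mult_right_mono) auto
      moreover have "0 \<le> 12 * \<delta> * N * (1 / (real d)\<^sup>2)" using \<open>\<delta> > 0\<close> by simp
      ultimately show ?thesis using False d unfolding eq by auto
    qed
  qed
  also have "\<dots> = 12 * \<delta> * N * (\<Sum>d\<in>{1<..2 * N}. 1 / (real d)\<^sup>2) +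
      2 * real N * (\<Sum>d\<in>{D<..2 * N}. 1 / (real d)\<^sup>2)"
  proof -
    have "{1<..2 * N} \<inter> {D<..2 * N} = {D<..2 * N}" using \<open>D > 0\<close> by auto
    then show ?thesis
      by (simp only: sum.distrib sum_distrib_left sum.inter_restrict[OF finite_greaterThanAtMost, symmetric])
  qed
  also have "\<dots> \<le> 12 * \<delta> * N * 1 + 2 * real N * (1 / D)"
  proof (intro add_mono mult_left_mono)
    show "(\<Sum>d\<in>{1<..2 * N}. 1 / (real d)\<^sup>2) \<le> 1"
      by (rule order.trans[OF sum_inverse_squares_le]) (use \<open>N > 0\<close> in auto)
    show "(\<Sum>d\<in>{D<..2 * N}. 1 / (real d)\<^sup>2) \<le> 1 / D"
      by (rule order.trans[OF sum_inverse_squares_le]) (use \<open>D > 0\<close> \<open>D \<le> N\<close> in auto)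
  qed (use \<open>\<delta> > 0\<close> in auto)
  also have "\<dots> \<le> 12 * \<delta> * N * 1 + 2 * real N * \<delta>"
    using \<delta> by (intro add_left_mono mult_left_mono) (auto simp: D_def field_simps)
  finally show ?thesis by (simp add: A_def N_def)
qed

text \<open>The constant is \<open>112 = 2 * (14 * 4)\<close>: the mean of \<open>\<Sum>p\<in>prime_factors n. 1 / p\<close> over the Bohr set is
  at most \<open>14 * 4\<close>, and \<open>exp\<close> lies above its tangent line.\<close>

lemma sum_totient_Bohr_ge:
  fixes \<gamma> \<delta> :: real and t :: nat
  assumes t: "t \<ge> t\<^sub>0" and \<delta>: "1 \<le> \<delta> * 4 ^ t" "\<delta> \<le> 1"
  shows "exp (-112) * card (Bohr \<gamma> \<delta> t) \<le> (\<Sum>n\<in>Bohr \<gamma> \<delta> t. totient n / real n)"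
proof -
  define A where "A = Bohr \<gamma> \<delta> t"
  define s where "s n = (\<Sum>p\<in>prime_factors n. 1 / real p)" for n :: nat
  have "2 * (\<Sum>n\<in>A. s n) \<le> 112 * card A"
    using sum_prime_factors_Bohr_le[OF t \<delta>(1), of \<gamma>] card_Bohr_ge[OF t \<delta>, of \<gamma>]
    unfolding A_def s_def by linarith
  then have "1 * real (card A) \<le> 113 * card A - 2 * (\<Sum>n\<in>A. s n)" by simp
  also have "\<dots> = (\<Sum>n\<in>A. 1 + (112 - 2 * s n))"
    by (simp add: sum.distrib sum_subtractf sum_distrib_left)
  finally have "exp (-112) * (1 * real (card A)) \<le> exp (-112) * (\<Sum>n\<in>A. 1 + (112 - 2 * s n))"
    by (intro mult_left_mono) auto
  also have "\<dots> = (\<Sum>n\<in>A. exp (-112) * (1 + (112 - 2 * s n)))" by (rule sum_distrib_left)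
  also have "\<dots> \<le> (\<Sum>n\<in>A. exp (-112) * exp (112 - 2 * s n))"
    by (intro sum_mono mult_left_mono exp_ge_add_one_self) auto
  also have "\<dots> = (\<Sum>n\<in>A. exp (- 2 * s n))" by (simp flip: exp_add)
  also have "\<dots> \<le> (\<Sum>n\<in>A. totient n / real n)"
  proof (rule sum_mono)
    fix n assume "n \<in> A"
    then have "n > 0" using B_ge by (auto simp: A_def Bohr_def intro: Nat.gr0I)
    then show "exp (- 2 * s n) \<le> totient n / real n"
      using totient_ge_exp[of n] by (simp add: s_def field_simps)
  qed
  finally show ?thesis by (simp add: A_def)
qed

end

section \<open>Quasi-independence\<close>

text \<open>Coprimality excludes \<open>a * m = b * n\<close>. With \<open>d = gcd n m\<close>, the nonzero multiple \<open>a * m - b * n\<close> of \<open>d\<close>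
  determines \<open>a\<close> modulo \<open>n / d\<close>, hence arises from at most \<open>d\<close> pairs.\<close>

lemma card_totative_pairs_le:
  fixes n m :: nat and X :: real
  assumes "n > 0" "m > 0" "n \<noteq> m" "X \<ge> 0"
  shows "card {(a, b) \<in> totatives n \<times> totatives m. \<bar>real a * m - real b * n\<bar> < X} \<le> 2 * X"
proof -
  define d where "d = gcd n m"
  define n' where "n' = n div d"
  define m' where "m' = m div d"
  have "d > 0" using assms by (simp add: d_def)
  have n: "n = d * n'" and m: "m = d * m'" by (simp_all add: d_def n'_def m'_def)
  have cop: "coprime n' m'" using assms unfolding n'_def m'_def d_def by (intro div_gcd_coprime) auto
  have "n' > 0" using assms n by (cases n') auto
  define P where "P = {(a, b) \<in> totatives n \<times> totatives m. \<bar>real a * m - real b * n\<bar> < X}"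
  define M where "M = \<lfloor>X / d\<rfloor>"
  \<comment> \<open>The first coordinate fixes a modulo \<open>n'\<close>; the second tells which of
    the d residue blocks contains a. The shift by 1 is needed because totatives range from 1 to n,
    not from 0.\<close>
  define f :: "nat \<times> nat \<Rightarrow> int \<times> nat"
    where "f = (\<lambda>(a, b). (int a * int m' - int b * int n', (a - 1) div n'))"
  have "f ` P \<subseteq> ({- M..M} - {0}) \<times> {0..<d}"
  proof
    fix y assume "y \<in> f ` P"
    then obtain a b where ab: "(a, b) \<in> P" "y = f (a, b)" by auto
    define t where "t = int a * int m' - int b * int n'"
    have a: "0 < a" "a \<le> n" "coprime a n" and b: "coprime b m"
      using ab by (auto simp: P_def in_totatives_iff)
    have "t \<noteq> 0"
    proof
      assume "t = 0"
      then have "int (a * m') = int (b * n')" by (simp add: t_def)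
      then have "a * m = b * n" unfolding m n by (simp only: of_nat_eq_iff mult.left_commute[of _ d])
      then have "n dvd a * m" "m dvd b * n" by (metis dvd_triv_right)+
      then have "n dvd m" "m dvd n" using a b
        by (metis coprime_commute coprime_dvd_mult_right_iff)+
      then show False using assms(3) dvd_antisym by blast
    qed
    moreover have "\<bar>t\<bar> \<le> M"
    proof -
      have "real a * m - real b * n = real d * of_int t"
        by (simp add: t_def m n algebra_simps)
      then have "real d * \<bar>of_int t\<bar> < X" using ab by (auto simp: P_def abs_mult)
      then have "\<bar>of_int t\<bar> \<le> X / d" using \<open>d > 0\<close> by (simp add: field_simps)
      then show ?thesis unfolding M_def by linarith
    qed
    moreover have "(a - 1) div n' < d"
    proof -
      have "a - 1 < d * n'" using a n by linarith
      then show ?thesis by (simp add: less_mult_imp_div_less)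
    qed
    ultimately show "y \<in> ({- M..M} - {0}) \<times> {0..<d}" by (auto simp: ab f_def t_def[symmetric])
  qed
  moreover have "inj_on f P"
  proof (rule inj_onI, clarify)
    fix a b a' b' assume ab: "(a, b) \<in> P" "(a', b') \<in> P" and eq: "f (a, b) = f (a', b')"
    have a: "0 < a" "0 < a'" using ab by (auto simp: P_def in_totatives_iff)
    have t: "(int a - int a') * int m' = (int b - int b') * int n'"
      and dv: "(a - 1) div n' = (a' - 1) div n'"
      using eq by (auto simp: f_def algebra_simps)
    have "int n' dvd (int a - int a') * int m'" unfolding t by simp
    then have "int n' dvd int a - int a'"
      using cop by (simp add: coprime_dvd_mult_left_iff)
    then have "int n' dvd int (a - 1) - int (a' - 1)" using a by (simp add: of_nat_diff)
    then have "(a - 1) mod n' = (a' - 1) mod n'"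
      by (metis mod_eq_dvd_iff of_nat_eq_iff zmod_int)
    then have "a - 1 = a' - 1" using dv by (metis div_mult_mod_eq)
    then have "a = a'" using a by linarith
    moreover from this have "b = b'" using t \<open>n' > 0\<close> by simp
    ultimately show "a = a' \<and> b = b'" by simp
  qed
  ultimately have "card P \<le> card (({- M..M} - {0}) \<times> {0..<d})"
    by (intro card_inj_on_le) auto
  moreover have "M \<ge> 0" using assms by (simp add: M_def)
  then have "card ({- M..M} - {0}) = nat (2 * M)" by (subst card_Diff_singleton) auto
  ultimately have "card P \<le> nat (2 * M) * d" by (simp add: card_cartesian_product)
  then have "real (card P) \<le> real (nat (2 * M) * d)" by (simp only: of_nat_le_iff)
  also have "\<dots> = 2 * of_int M * real d" using \<open>M \<ge> 0\<close> by simp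
  also have "\<dots> \<le> 2 * (X / d) * real d" by (intro mult_right_mono mult_left_mono) (auto simp: M_def)
  also have "\<dots> = 2 * X" using \<open>d > 0\<close> by simp
  finally show ?thesis by (simp add: P_def)
qed

section \<open>Overlaps of balls and the second moment method\<close>

lemma measure_Int_ball_real_le:
  fixes x y r s :: real
  assumes "0 \<le> r" "0 \<le> s"
  shows "measure lebesgue (ball x r \<inter> ball y s) \<le> (if \<bar>x - y\<bar> < r + s then 2 * min r s else 0)"
proof (cases "\<bar>x - y\<bar> < r + s")
  case True
  have "measure lebesgue (ball x r \<inter> ball y s) \<le> measure lebesgue (ball x r)"
    "measure lebesgue (ball x r \<inter> ball y s) \<le> measure lebesgue (ball y s)"
    by (intro measure_mono_fmeasurable; auto)+
  then show ?thesis using True assms by (simp add: ball_eq_greaterThanLessThan min_def)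
next
  case False
  have "ball x r \<inter> ball y s = {}"
  proof (intro equals0I)
    fix z assume "z \<in> ball x r \<inter> ball y s"
    then show False using False by (auto simp: dist_real_def)
  qed
  then show ?thesis using False by simp
qed

text \<open>Cauchy-Schwarz for the counting function of the sets against the indicator of their
  union, in division-free form. The proof minimizes a nonnegative quadratic in l; its minimizer
  divides by the measure of the union, so measure 0 is treated separately.\<close>

lemma measure_UN_second_moment:
  assumes "finite I" and A: "\<And>i. i \<in> I \<Longrightarrow> A i \<in> fmeasurable M"
  shows "(\<Sum>i\<in>I. measure M (A i))\<^sup>2 \<le>
    measure M (\<Union>i\<in>I. A i) * (\<Sum>i\<in>I. \<Sum>j\<in>I. measure M (A i \<inter> A j))"
proof -
  define U where "U = (\<Union>i\<in>I. A i)"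
  define S where "S = (\<Sum>i\<in>I. measure M (A i))"
  define Q where "Q = (\<Sum>i\<in>I. \<Sum>j\<in>I. measure M (A i \<inter> A j))"
  have U: "U \<in> fmeasurable M" unfolding U_def using assms by (intro fmeasurable.finite_UN) auto
  have int: "integrable M (indicat_real B)" "(\<integral>x. indicat_real B x \<partial>M) = measure M B"
    if "B \<in> fmeasurable M" for B
    using that by (auto simp: fmeasurable_def integrable_real_indicator integral_indicator sets.Int_space_eq2)
  have AA: "A i \<inter> A j \<in> fmeasurable M" if "i \<in> I" "j \<in> I" for i j
    using A that by (intro fmeasurable_Int_fmeasurable) (auto dest: fmeasurableD)
  have quad: "0 \<le> Q - 2 * l * S + l\<^sup>2 * measure M U" for l :: real
  proof -
    \<comment> \<open>On the union this is the square of the counting function minus l; outside it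
      vanishes.\<close>
    let ?f = "\<lambda>x. (\<Sum>i\<in>I. \<Sum>j\<in>I. indicat_real (A i \<inter> A j) x) -
      2 * l * (\<Sum>i\<in>I. indicat_real (A i) x) + l\<^sup>2 * indicat_real U x"
    have "?f x \<ge> 0" for x
    proof (cases "x \<in> U")
      case True
      have eq: "(\<Sum>i\<in>I. \<Sum>j\<in>I. indicat_real (A i \<inter> A j) x) = (\<Sum>i\<in>I. indicat_real (A i) x)\<^sup>2"
        by (simp add: power2_eq_square sum_product indicator_inter_arith)
      have "?f x = ((\<Sum>i\<in>I. indicat_real (A i) x) - l)\<^sup>2"
        unfolding eq using True by (simp add: power2_diff)
      then show ?thesis by simp
    next
      case False
      then have "\<And>i. i \<in> I \<Longrightarrow> x \<notin> A i" by (auto simp: U_def)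
      then show ?thesis using False by (simp add: indicator_inter_arith)
    qed
    then have "0 \<le> (\<integral>x. ?f x \<partial>M)" by (intro Bochner_Integration.integral_nonneg)
    also have "(\<integral>x. ?f x \<partial>M) = Q - 2 * l * S + l\<^sup>2 * measure M U"
      using int A AA U by (simp add: Q_def S_def)
    finally show ?thesis .
  qed
  show ?thesis
  proof (cases "measure M U = 0")
    case True
    have "measure M (A i) = 0" if "i \<in> I" for i
    proof -
      have "measure M (A i) \<le> measure M U"
        using that U A by (intro measure_mono_fmeasurable) (auto simp: U_def dest: fmeasurableD)
      then show ?thesis using True by (simp add: order_antisym)
    qed
    then show ?thesis using True by (simp add: U_def)
  next
    case False
    then have u: "measure M U > 0" using zero_less_measure_iff by blast
    have "0 \<le> Q - 2 * (S / measure M U) * S + (S / measure M U)\<^sup>2 * measure M U" by (rule quad)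
    also have "\<dots> = Q - S\<^sup>2 / measure M U" using u by (simp add: power2_eq_square)
    finally have "S\<^sup>2 \<le> measure M U * Q" using u by (simp add: field_simps)
    then show ?thesis by (simp add: S_def Q_def U_def)
  qed
qed

text \<open>The sets of the Duffin-Schaeffer theorem. Reduced fractions ensure that different
  positive n never share a centre.\<close>

definition reduced_approx :: "(nat \<Rightarrow> real) \<Rightarrow> nat \<Rightarrow> real set" where
  "reduced_approx \<psi> n = (\<Union>a\<in>totatives n. ball (real a / n) (\<psi> n / n))"

text \<open>Balls of radii r and s meet only if their centres are closer than
  \<open>2 * max r s\<close>, which \<open>card_totative_pairs_le\<close> allows for at most
  \<open>2 * X\<close> pairs, each overlapping in at most \<open>2 * min r s\<close>. Since
  \<open>max r s * min r s = r * s\<close>, the result is a plain product.\<close>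

lemma sum_measure_Int_approx_le:
  assumes "n > 0" "m > 0" "n \<noteq> m" "\<psi> n \<ge> 0" "\<psi> m \<ge> 0"
  shows "(\<Sum>a\<in>totatives n. \<Sum>b\<in>totatives m.
    measure lebesgue (ball (real a / n) (\<psi> n / n) \<inter> ball (real b / m) (\<psi> m / m))) \<le> 8 * \<psi> n * \<psi> m"
proof -
  define r where "r = \<psi> n / n"
  define s where "s = \<psi> m / m"
  have rs: "0 \<le> r" "0 \<le> s" using assms by (auto simp: r_def s_def)
  define X where "X = 2 * max r s * n * m"
  have "X \<ge> 0" using rs by (simp add: X_def)
  define P where "P = {(a, b) \<in> totatives n \<times> totatives m. \<bar>real a * m - real b * n\<bar> < X}"
  have "finite P" by (rule finite_subset[of _ "totatives n \<times> totatives m"]) (auto simp: P_def)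
  have "(\<Sum>a\<in>totatives n. \<Sum>b\<in>totatives m. measure lebesgue (ball (real a / n) r \<inter> ball (real b / m) s)) =
    (\<Sum>(a, b)\<in>totatives n \<times> totatives m. measure lebesgue (ball (real a / n) r \<inter> ball (real b / m) s))"
    by (simp add: sum.cartesian_product)
  also have "\<dots> \<le> (\<Sum>p\<in>totatives n \<times> totatives m. if p \<in> P then 2 * min r s else 0)"
  proof (rule sum_mono, clarify)
    fix a b assume ab: "a \<in> totatives n" "b \<in> totatives m"
    have "\<bar>real a * m - real b * n\<bar> = \<bar>real a / n - real b / m\<bar> * (n * m)"
    proof -
      have "real a * m - real b * n = (real a / n - real b / m) * (n * m)"
        using assms by (simp add: field_simps)
      then show ?thesis by (simp add: abs_mult)
    qed
    moreover have "\<bar>real a / n - real b / m\<bar> * (n * m) < X" if "\<bar>real a / n - real b / m\<bar> < r + s"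
    proof -
      have "\<bar>real a / n - real b / m\<bar> < 2 * max r s" using that by linarith
      then have "\<bar>real a / n - real b / m\<bar> * (n * m) < 2 * max r s * (n * m)"
        using assms by (intro mult_strict_right_mono) auto
      then show ?thesis by (simp add: X_def mult.assoc)
    qed
    ultimately have "\<bar>real a / n - real b / m\<bar> < r + s \<Longrightarrow> (a, b) \<in> P"
      using ab by (auto simp: P_def)
    then show "measure lebesgue (ball (real a / n) r \<inter> ball (real b / m) s) \<le>
        (if (a, b) \<in> P then 2 * min r s else 0)"
      using measure_Int_ball_real_le[OF rs, of "real a / n" "real b / m"] rs
      by (auto split: if_splits)
  qed
  also have "\<dots> = card P * (2 * min r s)"
  proof -
    have "(totatives n \<times> totatives m) \<inter> P = P" by (auto simp: P_def)
    then show ?thesis by (simp add: sum.If_cases Int_def[symmetric])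
  qed
  also have "\<dots> \<le> (2 * X) * (2 * min r s)"
    using card_totative_pairs_le[OF assms(1-3) \<open>X \<ge> 0\<close>] rs
    by (intro mult_right_mono) (auto simp: P_def)
  also have "\<dots> = 8 * (max r s * min r s) * n * m" by (simp add: X_def)
  also have "max r s * min r s = r * s" by (simp add: max_def min_def)
  also have "8 * (r * s) * n * m = 8 * \<psi> n * \<psi> m" using assms by (simp add: r_def s_def)
  finally show ?thesis by (simp add: r_def s_def)
qed

text \<open>For \<open>\<psi> n \<le> 1 / 2\<close> the balls with the same denominator are
  disjoint, so only the diagonal contributes.\<close>

lemma sum_measure_Int_approx_same_le:
  assumes "n > 0" "0 \<le> \<psi> n" "\<psi> n \<le> 1 / 2"
  shows "(\<Sum>a\<in>totatives n. \<Sum>b\<in>totatives n.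
    measure lebesgue (ball (real a / n) (\<psi> n / n) \<inter> ball (real b / n) (\<psi> n / n))) \<le> 2 * \<psi> n"
proof -
  have "(\<Sum>a\<in>totatives n. \<Sum>b\<in>totatives n.
    measure lebesgue (ball (real a / n) (\<psi> n / n) \<inter> ball (real b / n) (\<psi> n / n))) \<le>
    (\<Sum>a\<in>totatives n. \<Sum>b\<in>totatives n. if a = b then 2 * (\<psi> n / n) else 0)"
  proof (intro sum_mono)
    fix a b
    have "\<not> \<bar>real a / n - real b / n\<bar> < \<psi> n / n + \<psi> n / n" if "a \<noteq> b"
    proof -
      have "1 \<le> \<bar>real a - real b\<bar>" using that by linarith
      then have "\<psi> n + \<psi> n \<le> \<bar>real a - real b\<bar>" using assms by linarith
      then have "(\<psi> n + \<psi> n) / n \<le> \<bar>real a - real b\<bar> / n" by (simp add: divide_right_mono)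
      also have "\<dots> = \<bar>real a / n - real b / n\<bar>" by (simp add: diff_divide_distrib[symmetric])
      finally show ?thesis by (simp add: add_divide_distrib)
    qed
    moreover have "0 \<le> \<psi> n / n" using assms by simp
    ultimately show "measure lebesgue (ball (real a / n) (\<psi> n / n) \<inter> ball (real b / n) (\<psi> n / n)) \<le>
        (if a = b then 2 * (\<psi> n / n) else 0)"
      using measure_Int_ball_real_le[of "\<psi> n / n" "\<psi> n / n" "real a / n" "real b / n"]
      by (cases "a = b") (simp_all split: if_splits)
  qed
  also have "\<dots> = totient n * (2 * (\<psi> n / n))" by (simp add: totient_def)
  also have "\<dots> \<le> n * (2 * (\<psi> n / n))"
    using assms by (intro mult_right_mono) (auto intro: totient_le)
  also have "\<dots> = 2 * \<psi> n" using assms by simp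
  finally show ?thesis .
qed

text \<open>The second moment bound is applied to the single balls, indexed by pairs (n, a). With S
  the sum of the \<open>\<psi> n\<close>, the first moment is at least
  \<open>2 * \<kappa> * S\<close> and the second at most
  \<open>8 * S\<^sup>2 + 2 * S \<le> 10 * S\<^sup>2\<close>, because S is at least 1; the ratio no
  longer depends on S.\<close>

lemma measure_UN_reduced_approx_ge:
  assumes F: "finite F" "\<And>n. n \<in> F \<Longrightarrow> n > 0"
    and \<psi>: "\<And>n. n \<in> F \<Longrightarrow> 0 \<le> \<psi> n \<and> \<psi> n \<le> 1 / 2"
    and large: "1 \<le> (\<Sum>n\<in>F. \<psi> n)"
    and \<kappa>: "0 \<le> \<kappa>" "\<kappa> * (\<Sum>n\<in>F. \<psi> n) \<le> (\<Sum>n\<in>F. \<psi> n * (totient n / real n))"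
  shows "2 / 5 * \<kappa>\<^sup>2 \<le> measure lebesgue (\<Union>n\<in>F. reduced_approx \<psi> n)"
proof -
  define S where "S = (\<Sum>n\<in>F. \<psi> n)"
  define I where "I = Sigma F totatives"
  define A where "A = (\<lambda>(n, a). ball (real a / real n) (\<psi> n / n))"
  define u where "u = measure lebesgue (\<Union>n\<in>F. reduced_approx \<psi> n)"
  have "finite I" using F by (simp add: I_def)
  have Aeq: "(\<Union>i\<in>I. A i) = (\<Union>n\<in>F. reduced_approx \<psi> n)"
    by (auto simp: I_def A_def reduced_approx_def)
  have Am: "A i \<in> lmeasurable" for i by (auto simp: A_def split: prod.splits)
  have sum_I: "(\<Sum>i\<in>I. g i) = (\<Sum>n\<in>F. \<Sum>a\<in>totatives n. g (n, a))" for g :: "nat \<times> nat \<Rightarrow> real"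
    using F by (simp add: I_def sum.Sigma)
  have T: "(\<Sum>i\<in>I. measure lebesgue (A i)) = 2 * (\<Sum>n\<in>F. \<psi> n * (totient n / real n))"
  proof -
    have "(\<Sum>i\<in>I. measure lebesgue (A i)) = (\<Sum>n\<in>F. \<Sum>a\<in>totatives n. measure lebesgue (A (n, a)))"
      by (rule sum_I)
    also have "\<dots> = (\<Sum>n\<in>F. \<Sum>a\<in>totatives n. 2 * (\<psi> n / n))"
      using \<psi> by (intro sum.cong refl) (simp add: A_def ball_eq_greaterThanLessThan)
    also have "\<dots> = 2 * (\<Sum>n\<in>F. \<psi> n * (totient n / real n))"
      by (simp add: totient_def sum_distrib_left mult_ac)
    finally show ?thesis .
  qed
  have "(\<Sum>i\<in>I. \<Sum>j\<in>I. measure lebesgue (A i \<inter> A j)) =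
      (\<Sum>n\<in>F. \<Sum>a\<in>totatives n. \<Sum>m\<in>F. \<Sum>b\<in>totatives m. measure lebesgue (A (n, a) \<inter> A (m, b)))"
    by (simp only: sum_I)
  also have "\<dots> = (\<Sum>n\<in>F. \<Sum>m\<in>F. \<Sum>a\<in>totatives n. \<Sum>b\<in>totatives m. measure lebesgue (A (n, a) \<inter> A (m, b)))"
    by (intro sum.cong refl sum.swap)
  also have "\<dots> \<le> (\<Sum>n\<in>F. \<Sum>m\<in>F. 8 * \<psi> n * \<psi> m + (if n = m then 2 * \<psi> n else 0))"
  proof (intro sum_mono)
    fix n m assume nm: "n \<in> F" "m \<in> F"
    show "(\<Sum>a\<in>totatives n. \<Sum>b\<in>totatives m. measure lebesgue (A (n, a) \<inter> A (m, b)))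
        \<le> 8 * \<psi> n * \<psi> m + (if n = m then 2 * \<psi> n else 0)"
    proof (cases "n = m")
      case True
      have "0 \<le> 8 * \<psi> m * \<psi> m" using \<psi> nm by simp
      moreover have "(\<Sum>a\<in>totatives m. \<Sum>b\<in>totatives m. measure lebesgue (A (m, a) \<inter> A (m, b))) \<le> 2 * \<psi> m"
        using sum_measure_Int_approx_same_le[of m \<psi>] F(2) \<psi> nm by (simp add: A_def)
      ultimately show ?thesis unfolding True by (simp only: simp_thms if_True)
    next
      case False
      then show ?thesis
        using sum_measure_Int_approx_le[of n m \<psi>] F \<psi> nm by (simp add: A_def)
    qed
  qed
  also have "\<dots> = 8 * S\<^sup>2 + 2 * S"
  proof -
    have "8 * S\<^sup>2 = (\<Sum>n\<in>F. \<Sum>m\<in>F. 8 * \<psi> n * \<psi> m)"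
      unfolding S_def power2_eq_square sum_product by (simp add: sum_distrib_left mult.assoc)
    moreover have "2 * S = (\<Sum>n\<in>F. \<Sum>m\<in>F. if n = m then 2 * \<psi> n else 0)"
      using F by (simp add: S_def sum_distrib_left)
    ultimately show ?thesis by (simp add: sum.distrib)
  qed
  also have "\<dots> \<le> 10 * S\<^sup>2"
    using large by (simp add: S_def power2_eq_square)
  finally have Q: "(\<Sum>i\<in>I. \<Sum>j\<in>I. measure lebesgue (A i \<inter> A j)) \<le> 10 * S\<^sup>2" .
  have "(2 * (\<kappa> * S))\<^sup>2 \<le> (\<Sum>i\<in>I. measure lebesgue (A i))\<^sup>2"
    unfolding T using \<kappa> large by (intro power_mono mult_left_mono) (auto simp: S_def)
  also have "\<dots> \<le> u * (\<Sum>i\<in>I. \<Sum>j\<in>I. measure lebesgue (A i \<inter> A j))"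
    using measure_UN_second_moment[OF \<open>finite I\<close>, of A lebesgue] Am unfolding Aeq u_def by blast
  also have "\<dots> \<le> u * (10 * S\<^sup>2)" using Q by (intro mult_left_mono) (auto simp: u_def)
  finally have "(4 * \<kappa>\<^sup>2) * S\<^sup>2 \<le> (10 * u) * S\<^sup>2" by (simp add: power_mult_distrib mult_ac)
  moreover have "S\<^sup>2 > 0" using large by (simp add: S_def)
  ultimately have "4 * \<kappa>\<^sup>2 \<le> 10 * u" by (simp only: mult_le_cancel_right_pos)
  then show ?thesis by (simp add: u_def)
qed

section \<open>Divergence\<close>

lemma harmonic_tail_unbounded:
  "\<exists>T'\<ge>T. X \<le> (\<Sum>t\<in>{T<..T'}. 1 / real t)"
proof -
  obtain T' where T': "T' \<ge> T" "X + harm T \<le> (harm T' :: real)"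
    using harm_at_top[unfolded filterlim_at_top, rule_format, of "X + harm T"]
    by (auto simp: eventually_sequentially) (metis nat_le_linear le_refl)
  have "{1..T'} = {1..T} \<union> {T<..T'}" using T'(1) by auto
  then have "(harm T' :: real) = harm T + (\<Sum>t\<in>{T<..T'}. 1 / real t)"
    unfolding harm_def by (simp only:) (subst sum.union_disjoint; auto simp: inverse_eq_divide)
  then show ?thesis using T' by auto
qed

text \<open>Used in both directions of the argument: to conclude that the limit inferior vanishes,
  and, by contraposition, to extract a lower bound from the failure of the Liouville
  property.\<close>

lemma liminf_ereal_eq_0:
  assumes "\<And>n. 0 \<le> f n" and "\<And>(m::nat) K. \<exists>n\<ge>K. f n < 1 / Suc m"
  shows "liminf (\<lambda>n. ereal (f n)) = 0"
proof (rule antisym)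
  show "0 \<le> liminf (\<lambda>n. ereal (f n))"
    using assms(1) by (intro Liminf_bounded always_eventually) auto
  show "liminf (\<lambda>n. ereal (f n)) \<le> 0"
  proof (rule ccontr)
    assume "\<not> ?thesis"
    then have "0 < liminf (\<lambda>n. ereal (f n))" by simp
    then obtain e where e: "0 < ereal e" "ereal e < liminf (\<lambda>n. ereal (f n))"
      using ereal_dense2 by blast
    obtain K where K: "\<And>n. n \<ge> K \<Longrightarrow> e < f n"
      using less_LiminfD[OF e(2)] by (auto simp: eventually_sequentially)
    obtain m where "1 / real (Suc m) < e"
      using reals_Archimedean[of e] e(1) by (auto simp: inverse_eq_divide)
    then show False using assms(2)[of K m] K by fastforce
  qed
qed

text \<open>A nonzero limit inferior bounds the terms below from some index K on. The finitely many
  earlier terms are positive by irrationality and enter the minimum that defines c; the real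
  exponent is rounded up.\<close>

lemma obtain_diophantine:
  assumes "\<alpha> \<notin> \<rat>" "\<not> Liouville \<alpha>"
  obtains c w where "diophantine \<alpha> c w"
proof -
  obtain w where w: "w > 0"
    "liminf (\<lambda>n::nat. ereal (real n powr w * int_dist (real n * \<alpha>))) \<noteq> 0"
    using assms by (auto simp: Liouville_def)
  obtain m K where mK: "\<And>n::nat. n \<ge> K \<Longrightarrow> 1 / Suc m \<le> real n powr w * int_dist (real n * \<alpha>)"
    using liminf_ereal_eq_0[of "\<lambda>n. real n powr w * int_dist (real n * \<alpha>)"] w(2) by (force simp: not_less)
  define v where "v = nat \<lceil>w\<rceil>"
  define f where "f n = real n ^ v * int_dist (real n * \<alpha>)" for n :: nat
  define c where "c = Min (insert (1 / Suc m) (f ` {1..K}))"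
  have f_pos: "f n > 0" if "n > 0" for n
  proof -
    have "real n * \<alpha> \<notin> \<rat>"
      using assms(1) that Rats_divide[of "real n * \<alpha>" "real n"] by auto
    then show ?thesis using that by (simp add: f_def int_dist_pos)
  qed
  have "c > 0" unfolding c_def by (subst Min_gr_iff) (auto intro: f_pos)
  moreover have "c \<le> f n" if "n > 0" for n
  proof (cases "n \<le> K")
    case True
    then show ?thesis using that unfolding c_def by (intro Min_le) auto
  next
    case False
    have "c \<le> 1 / Suc m" unfolding c_def by (intro Min_le) auto
    also have "\<dots> \<le> real n powr w * int_dist (real n * \<alpha>)" using mK False by simp
    also have "real n powr w \<le> real n powr v"
      using that w(1) by (intro powr_mono) (auto simp: v_def)
    then have "real n powr w * int_dist (real n * \<alpha>) \<le> f n"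
      using that by (simp add: f_def powr_realpow mult_right_mono)
    finally show ?thesis .
  qed
  ultimately have "diophantine \<alpha> c v" by unfold_locales (auto simp: f_def)
  then show ?thesis by (rule that)
qed

section \<open>Annuli and the divergent sum\<close>

context diophantine
begin

text \<open>The shifted centre turns a ball into the condition \<open>2 * \<delta> \<le> int_dist (n * \<alpha> - \<gamma>) \<le> 4 * \<delta>\<close> with
  \<open>\<delta> = 1 / 4 ^ j\<close>.\<close>

definition annulus :: "real \<Rightarrow> nat \<Rightarrow> nat \<Rightarrow> nat set" where
  "annulus \<gamma> t j = Bohr (\<gamma> + 3 * (1 / 4 ^ j)) (1 / 4 ^ j) t"

lemma finite_annulus [simp]: "finite (annulus \<gamma> t j)"
  by (simp add: annulus_def)

lemma annulus_range: "n \<in> annulus \<gamma> t j \<Longrightarrow> B ^ t \<le> n \<and> n < 2 * B ^ t"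
  by (auto simp: annulus_def Bohr_def)

text \<open>With \<open>j \<ge> 2\<close> the width is at most 1 / 16, so an integer other than the
  one near \<open>x - 3 * \<delta>\<close> is too far from x to spoil the lower bound.\<close>

lemma int_dist_annulus:
  assumes "n \<in> annulus \<gamma> t j" "j \<ge> 2"
  shows "2 / 4 ^ j \<le> int_dist (real n * \<alpha> - \<gamma>)" "int_dist (real n * \<alpha> - \<gamma>) \<le> 4 / 4 ^ j"
proof -
  define \<delta> :: real where "\<delta> = 1 / 4 ^ j"
  define x where "x = real n * \<alpha> - \<gamma>"
  have "(4::real) ^ 2 \<le> 4 ^ j" using assms(2) by (intro power_increasing) auto
  then have \<delta>: "0 < \<delta>" "\<delta> \<le> 1 / 16" by (auto simp: \<delta>_def field_simps)
  have "int_dist (x - 3 * \<delta>) \<le> \<delta>"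
    using assms(1) by (simp add: annulus_def Bohr_def x_def \<delta>_def algebra_simps)
  then obtain k :: int where k: "\<bar>x - 3 * \<delta> - k\<bar> \<le> \<delta>"
    by (metis obtain_int_dist)
  obtain l where l: "int_dist x = \<bar>x - of_int l\<bar>" by (rule obtain_int_dist)
  have "2 * \<delta> \<le> int_dist x"
  proof (cases "l = k")
    case True
    then show ?thesis using k l by linarith
  next
    case False
    then have "1 \<le> \<bar>real_of_int l - real_of_int k\<bar>" by linarith
    then show ?thesis using k l \<delta> by linarith
  qed
  moreover have "int_dist x \<le> 4 * \<delta>" using int_dist_le[of x k] k by linarith
  ultimately show "2 / 4 ^ j \<le> int_dist (real n * \<alpha> - \<gamma>)" "int_dist (real n * \<alpha> - \<gamma>) \<le> 4 / 4 ^ j"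
    by (simp_all add: x_def \<delta>_def)
qed

text \<open>The lower limit on j is the one required by \<open>int_dist_annulus\<close>; the upper
  limit gives \<open>\<delta> * 4 ^ t \<ge> 1\<close>, as the counting lemmas demand.\<close>

definition layer :: "real \<Rightarrow> nat \<Rightarrow> nat set" where
  "layer \<gamma> t = (\<Union>j\<in>{2..t}. annulus \<gamma> t j)"

lemma finite_layer [simp]: "finite (layer \<gamma> t)"
  by (simp add: layer_def)

text \<open>Each annulus spans a factor 2 in \<open>int_dist\<close>, while consecutive scales
  differ by a factor 4, so the annuli are disjoint.\<close>

lemma sum_layer:
  fixes g :: "nat \<Rightarrow> real"
  shows "(\<Sum>n\<in>layer \<gamma> t. g n) = (\<Sum>j\<in>{2..t}. \<Sum>n\<in>annulus \<gamma> t j. g n)"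
proof -
  have disj: False if "n \<in> annulus \<gamma> t i" "n \<in> annulus \<gamma> t j" "2 \<le> i" "i < j" for n i j
  proof -
    have "(4::real) ^ Suc i \<le> 4 ^ j" using that by (intro power_increasing) auto
    then have "4 / (4::real) ^ j \<le> 4 / 4 ^ Suc i" by (intro divide_left_mono) auto
    then have "4 / (4::real) ^ j \<le> 1 / 4 ^ i" by simp
    moreover have "2 / (4::real) ^ i \<le> 4 / 4 ^ j"
      using int_dist_annulus(1)[OF that(1)] int_dist_annulus(2)[OF that(2)] that by linarith
    ultimately have "2 / (4::real) ^ i \<le> 1 / 4 ^ i" by linarith
    then show False by (simp add: field_simps)
  qed
  show ?thesis unfolding layer_def
    by (rule sum.UNION_disjoint) (auto dest: disj simp: neq_iff)
qed

lemma sum_UN_layer: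
  fixes g :: "nat \<Rightarrow> real"
  shows "(\<Sum>n\<in>(\<Union>t\<in>{T<..T'}. layer \<gamma> t). g n) = (\<Sum>t\<in>{T<..T'}. \<Sum>n\<in>layer \<gamma> t. g n)"
proof -
  have disj: False if "n \<in> layer \<gamma> s" "n \<in> layer \<gamma> t" "s < t" for n s t
  proof -
    have "n < 2 * B ^ s" "B ^ t \<le> n" using that annulus_range by (auto simp: layer_def)
    moreover have "2 * B ^ s \<le> B * B ^ s" using B_ge by (intro mult_right_mono) auto
    moreover have "B ^ Suc s \<le> B ^ t" using that B_ge by (intro power_increasing) auto
    ultimately show False unfolding power_Suc by linarith
  qed
  show ?thesis
    by (rule sum.UNION_disjoint) (auto dest: disj simp: neq_iff)
qed

text \<open>Where the denominator is positive,
  \<open>int_dist (n * \<beta>) < \<psi> \<gamma> \<epsilon> n\<close> says exactly that the product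
  in the theorem is below \<open>\<epsilon>\<close>.\<close>

definition \<psi> :: "real \<Rightarrow> real \<Rightarrow> nat \<Rightarrow> real" where
  "\<psi> \<gamma> \<epsilon> n = \<epsilon> / (n * (ln n)\<^sup>2 * int_dist (real n * \<alpha> - \<gamma>))"

lemma ln_B_ge: "1 \<le> ln (real B)"
proof -
  have "exp (1::real) \<le> 3" by (rule exp_le)
  then have "exp 1 \<le> real B" using B_ge by linarith
  then show ?thesis using B_ge by (subst ln_ge_iff) auto
qed

text \<open>Over an annulus n varies by a factor 2, the squared logarithm by at most 4 and the
  distance by 2, hence the factor 16; sums of \<open>\<psi>\<close> thereby reduce to cardinalities.
  The third bound drops the logarithm and later yields \<open>\<psi> \<le> 1 / 2\<close>.\<close>

lemma \<psi>_annulus_bounds: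
  assumes "t \<ge> 1" "j \<ge> 2" "n \<in> annulus \<gamma> t j" "0 < \<epsilon>"
  defines "N \<equiv> B ^ t"
  defines "lo \<equiv> \<epsilon> * 4 ^ j / (8 * real N * (ln (2 * real N))\<^sup>2)"
  shows "lo \<le> \<psi> \<gamma> \<epsilon> n" "\<psi> \<gamma> \<epsilon> n \<le> 16 * lo" "\<psi> \<gamma> \<epsilon> n \<le> \<epsilon> * 4 ^ j / (2 * real N)"
proof -
  define D where "D = int_dist (real n * \<alpha> - \<gamma>)"
  have D: "2 / 4 ^ j \<le> D" "D \<le> 4 / 4 ^ j" using int_dist_annulus[OF assms(3,2)] by (auto simp: D_def)
  then have "D > 0" by (meson less_le_trans zero_less_divide_iff zero_less_numeral zero_less_power)
  have n: "N \<le> n" "n \<le> 2 * N" using annulus_range[OF assms(3)] by (auto simp: N_def)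
  have "B ^ 1 \<le> N" unfolding N_def using assms(1) B_ge by (intro power_increasing) auto
  then have "N \<ge> 8" using B_ge by simp
  have "ln (real B) \<le> ln (real N)" using \<open>B ^ 1 \<le> N\<close> B_ge by simp
  then have lnN: "1 \<le> ln (real N)" using ln_B_ge by linarith
  have ln: "ln (real N) \<le> ln n" "ln n \<le> ln (2 * real N)" using n \<open>N \<ge> 8\<close> by auto
  have "ln (2 * real N) = ln 2 + ln (real N)" using \<open>N \<ge> 8\<close> by (simp add: ln_mult)
  moreover have "ln (2::real) \<le> ln (real N)" using \<open>N \<ge> 8\<close> by simp
  ultimately have ln2: "ln (2 * real N) \<le> 2 * ln (real N)" by linarith
  have pos: "0 < real n * (ln n)\<^sup>2 * D" using n ln lnN \<open>N \<ge> 8\<close> \<open>D > 0\<close> by simp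
  have upper: "real n * (ln n)\<^sup>2 * D \<le> (2 * real N) * (ln (2 * real N))\<^sup>2 * (4 / 4 ^ j)"
    using n ln lnN D \<open>D > 0\<close> by (intro mult_mono power_mono) auto
  have "\<epsilon> / ((2 * real N) * (ln (2 * real N))\<^sup>2 * (4 / 4 ^ j)) \<le> \<epsilon> / (real n * (ln n)\<^sup>2 * D)"
    using assms(4) by (intro frac_le pos upper) auto
  then show "lo \<le> \<psi> \<gamma> \<epsilon> n" by (simp add: lo_def \<psi>_def D_def)
  have lower: "real N * (ln (real N))\<^sup>2 * (2 / 4 ^ j) \<le> real n * (ln n)\<^sup>2 * D"
    using n ln lnN D by (intro mult_mono power_mono) auto
  have "(ln (2 * real N))\<^sup>2 \<le> (2 * ln (real N))\<^sup>2" using ln2 ln lnN by (intro power_mono) auto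
  then have "real N * (ln (2 * real N))\<^sup>2 * (1 / (2 * 4 ^ j)) \<le> real N * (4 * (ln (real N))\<^sup>2) * (1 / (2 * 4 ^ j))"
    by (intro mult_left_mono mult_right_mono) (auto simp: power_mult_distrib)
  also have "\<dots> = real N * (ln (real N))\<^sup>2 * (2 / 4 ^ j)" by simp
  also note lower
  finally have "real N * (ln (2 * real N))\<^sup>2 * (1 / (2 * 4 ^ j)) \<le> real n * (ln n)\<^sup>2 * D" .
  then have "\<epsilon> / (real n * (ln n)\<^sup>2 * D) \<le> \<epsilon> / (real N * (ln (2 * real N))\<^sup>2 * (1 / (2 * 4 ^ j)))"
    using \<open>N \<ge> 8\<close> lnN ln assms(4) by (intro frac_le mult_pos_pos zero_less_power) auto
  then show "\<psi> \<gamma> \<epsilon> n \<le> 16 * lo" by (simp add: lo_def \<psi>_def D_def mult_ac)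
  have "1 \<le> (ln (real N))\<^sup>2" using lnN by simp
  then have "real N * 1 * (2 / 4 ^ j) \<le> real N * (ln (real N))\<^sup>2 * (2 / 4 ^ j)"
    by (intro mult_left_mono mult_right_mono) auto
  also note lower
  finally have "\<epsilon> / (real n * (ln n)\<^sup>2 * D) \<le> \<epsilon> / (real N * 1 * (2 / 4 ^ j))"
    using \<open>N \<ge> 8\<close> assms(4) by (intro frac_le mult_pos_pos) auto
  then show "\<psi> \<gamma> \<epsilon> n \<le> \<epsilon> * 4 ^ j / (2 * real N)" by (simp add: \<psi>_def D_def mult_ac)
qed

text \<open>The average of \<open>totient n / n\<close> on a Bohr set is at least
  \<open>exp (- 112)\<close>; the 16 is the variation of \<open>\<psi>\<close> on an
  annulus.\<close>

definition \<kappa> :: real where "\<kappa> = exp (- 112) / 16"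

lemma \<kappa>_pos: "\<kappa> > 0"
  by (simp add: \<kappa>_def)

text \<open>In \<open>lo * card A\<close> the factors \<open>4 ^ j\<close> and N cancel, leaving
  \<open>\<epsilon> / (32 * (ln (2 * N))\<^sup>2)\<close>. The estimate
  \<open>ln (2 * N) \<le> 2 * t * ln B\<close> turns 32 into 128.\<close>

lemma sum_\<psi>_annulus:
  assumes "t \<ge> t\<^sub>0" "t \<ge> 2" "j \<in> {2..t}" "0 < \<epsilon>"
  shows "\<epsilon> / (128 * (ln B)\<^sup>2 * (real t)\<^sup>2) \<le> (\<Sum>n\<in>annulus \<gamma> t j. \<psi> \<gamma> \<epsilon> n)"
    and "\<kappa> * (\<Sum>n\<in>annulus \<gamma> t j. \<psi> \<gamma> \<epsilon> n) \<le> (\<Sum>n\<in>annulus \<gamma> t j. \<psi> \<gamma> \<epsilon> n * (totient n / real n))"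
proof -
  define N where "N = B ^ t"
  define A where "A = annulus \<gamma> t j"
  define lo where "lo = \<epsilon> * 4 ^ j / (8 * real N * (ln (2 * real N))\<^sup>2)"
  have "N > 0" using B_ge by (simp add: N_def)
  have "lo \<ge> 0" using assms(4) by (simp add: lo_def)
  have bounds: "lo \<le> \<psi> \<gamma> \<epsilon> n" "\<psi> \<gamma> \<epsilon> n \<le> 16 * lo" if "n \<in> A" for n
    using \<psi>_annulus_bounds[of t j n \<gamma> \<epsilon>] that assms by (auto simp: A_def lo_def N_def)
  have \<delta>: "1 \<le> 1 / 4 ^ j * (4::real) ^ t" "1 / 4 ^ j \<le> (1::real)"
    using assms(3) power_increasing[of j t "4::real"] by auto
  have L: "ln (real B) \<ge> 1" by (rule ln_B_ge)
  have "ln (2 * real N) = ln 2 + t * ln (real B)"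
    using B_ge by (simp add: N_def ln_mult ln_realpow)
  moreover have "ln 2 \<le> 1 * ln (real B)" using B_ge by simp
  moreover have "1 * ln (real B) \<le> t * ln (real B)" using L assms(2) by (intro mult_right_mono) auto
  ultimately have ln2N: "ln (2 * real N) \<le> 2 * (t * ln (real B))" by linarith
  have ln2N_pos: "0 < ln (2 * real N)" using \<open>N > 0\<close> by simp
  have "\<epsilon> / (128 * (ln B)\<^sup>2 * (real t)\<^sup>2) = \<epsilon> / (32 * (2 * (t * ln (real B)))\<^sup>2)"
    by (simp add: power_mult_distrib mult_ac)
  also have "\<dots> \<le> \<epsilon> / (32 * (ln (2 * real N))\<^sup>2)"
    using ln2N ln2N_pos L assms(2,4)
    by (intro divide_left_mono mult_left_mono power_mono mult_pos_pos zero_less_power) auto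
  also have "\<dots> = lo * (1 / 4 ^ j * N / 4)" using \<open>N > 0\<close> by (simp add: lo_def)
  also have "\<dots> \<le> lo * card A"
    using card_Bohr_ge[OF assms(1) \<delta>] \<open>lo \<ge> 0\<close>
    unfolding A_def annulus_def N_def by (intro mult_left_mono) auto
  also have "\<dots> = (\<Sum>n\<in>A. lo)" by simp
  also have "\<dots> \<le> (\<Sum>n\<in>A. \<psi> \<gamma> \<epsilon> n)" by (intro sum_mono bounds)
  finally show "\<epsilon> / (128 * (ln B)\<^sup>2 * (real t)\<^sup>2) \<le> (\<Sum>n\<in>annulus \<gamma> t j. \<psi> \<gamma> \<epsilon> n)"
    by (simp add: A_def)
  have "\<kappa> * (\<Sum>n\<in>A. \<psi> \<gamma> \<epsilon> n) \<le> \<kappa> * (\<Sum>n\<in>A. 16 * lo)"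
    using \<kappa>_pos by (intro mult_left_mono sum_mono bounds) auto
  also have "\<dots> = lo * (exp (- 112) * card A)" by (simp add: \<kappa>_def)
  also have "\<dots> \<le> lo * (\<Sum>n\<in>A. totient n / real n)"
    unfolding A_def annulus_def
    by (rule mult_left_mono[OF sum_totient_Bohr_ge[OF assms(1) \<delta>] \<open>lo \<ge> 0\<close>])
  also have "\<dots> = (\<Sum>n\<in>A. lo * (totient n / real n))" by (rule sum_distrib_left)
  also have "\<dots> \<le> (\<Sum>n\<in>A. \<psi> \<gamma> \<epsilon> n * (totient n / real n))"
    by (intro sum_mono mult_right_mono bounds) auto
  finally show "\<kappa> * (\<Sum>n\<in>annulus \<gamma> t j. \<psi> \<gamma> \<epsilon> n) \<le>
      (\<Sum>n\<in>annulus \<gamma> t j. \<psi> \<gamma> \<epsilon> n * (totient n / real n))"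
    by (simp add: A_def)
qed

text \<open>The number of annuli is \<open>t - 1 \<ge> t / 2\<close>, which cancels one of the two
  factors t and leaves a harmonic term.\<close>

lemma sum_\<psi>_layer:
  assumes "t \<ge> t\<^sub>0" "t \<ge> 2" "0 < \<epsilon>"
  shows "\<epsilon> / (256 * (ln B)\<^sup>2) * (1 / real t) \<le> (\<Sum>n\<in>layer \<gamma> t. \<psi> \<gamma> \<epsilon> n)"
    and "\<kappa> * (\<Sum>n\<in>layer \<gamma> t. \<psi> \<gamma> \<epsilon> n) \<le> (\<Sum>n\<in>layer \<gamma> t. \<psi> \<gamma> \<epsilon> n * (totient n / real n))"
proof -
  have "\<epsilon> / (256 * (ln B)\<^sup>2) * (1 / real t) = (t / 2) * (\<epsilon> / (128 * (ln B)\<^sup>2 * (real t)\<^sup>2))"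
    using assms(2) by (simp add: power2_eq_square)
  also have "\<dots> \<le> real (t - 1) * (\<epsilon> / (128 * (ln B)\<^sup>2 * (real t)\<^sup>2))"
    using assms by (intro mult_right_mono) auto
  also have "\<dots> = (\<Sum>j\<in>{2..t}. \<epsilon> / (128 * (ln B)\<^sup>2 * (real t)\<^sup>2))" by simp
  also have "\<dots> \<le> (\<Sum>j\<in>{2..t}. \<Sum>n\<in>annulus \<gamma> t j. \<psi> \<gamma> \<epsilon> n)"
    using assms by (intro sum_mono sum_\<psi>_annulus(1)) auto
  finally show "\<epsilon> / (256 * (ln B)\<^sup>2) * (1 / real t) \<le> (\<Sum>n\<in>layer \<gamma> t. \<psi> \<gamma> \<epsilon> n)"
    by (simp only: sum_layer)
  show "\<kappa> * (\<Sum>n\<in>layer \<gamma> t. \<psi> \<gamma> \<epsilon> n) \<le> (\<Sum>n\<in>layer \<gamma> t. \<psi> \<gamma> \<epsilon> n * (totient n / real n))"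
    unfolding sum_layer sum_distrib_left[of \<kappa> _ "{2..t}"]
    using assms by (intro sum_mono sum_\<psi>_annulus(2)) auto
qed

text \<open>A smaller \<open>\<epsilon>\<close> or a larger K only requires more layers until the
  sum of \<open>\<psi>\<close> reaches 1; the measure bound stays the same.\<close>

lemma exists_large_approximation_set:
  fixes K :: nat
  assumes \<epsilon>: "0 < \<epsilon>" "\<epsilon> \<le> 1"
  shows "\<exists>V\<in>lmeasurable. V \<subseteq> {- 1..2} \<and> 2 / 5 * \<kappa>\<^sup>2 \<le> measure lebesgue V \<and>
    (\<forall>\<beta>\<in>V. \<exists>n\<ge>K. real n * (ln n)\<^sup>2 * int_dist (real n * \<alpha> - \<gamma>) * int_dist (real n * \<beta>) < \<epsilon>)"
proof -
  \<comment> \<open>Taking T at least K forces \<open>n \<ge> K\<close>, because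
    \<open>t < 2 ^ t \<le> B ^ t \<le> n\<close> for n in layer t.\<close>
  define T where "T = max (max t\<^sub>0 2) K"
  define C where "C = \<epsilon> / (256 * (ln B)\<^sup>2)"
  have "C > 0" using \<epsilon> ln_B_ge by (auto simp: C_def intro!: divide_pos_pos)
  obtain T' where T': "1 / C \<le> (\<Sum>t\<in>{T<..T'}. 1 / real t)"
    using harmonic_tail_unbounded by blast
  define F where "F = (\<Union>t\<in>{T<..T'}. layer \<gamma> t)"
  have "finite F" by (auto simp: F_def layer_def)
  have F: "n \<ge> K \<and> n \<ge> 2 \<and> 0 < int_dist (real n * \<alpha> - \<gamma>) \<and> 0 \<le> \<psi> \<gamma> \<epsilon> n \<and> \<psi> \<gamma> \<epsilon> n \<le> 1 / 2" if "n \<in> F" for n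
  proof -
    obtain t j where t: "T < t" and j: "2 \<le> j" "j \<le> t" and n: "n \<in> annulus \<gamma> t j"
      using \<open>n \<in> F\<close> by (auto simp: F_def layer_def)
    have "t < 2 ^ t" by (rule less_exp)
    also have "\<dots> \<le> B ^ t" using B_ge by (intro power_mono) auto
    also have "\<dots> \<le> n" using annulus_range[OF n] by simp
    finally have "t < n" .
    have "(4::real) ^ j \<le> 4 ^ t" using j by (intro power_increasing) auto
    also have "\<dots> \<le> real (B ^ t)"
      using four_power_le_B_power[of t] by (metis of_nat_le_iff of_nat_numeral of_nat_power)
    finally have jB: "(4::real) ^ j \<le> real (B ^ t)" .
    have "\<epsilon> * 4 ^ j \<le> 1 * real (B ^ t)" using \<epsilon> jB by (intro mult_mono) auto
    then have "\<epsilon> * 4 ^ j / (2 * real (B ^ t)) \<le> 1 / 2" using B_ge by (simp add: field_simps)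
    then have "\<psi> \<gamma> \<epsilon> n \<le> 1 / 2"
      using \<psi>_annulus_bounds(3)[OF _ j(1) n \<epsilon>(1)] t by simp
    moreover have "0 \<le> \<psi> \<gamma> \<epsilon> n" using \<epsilon> by (simp add: \<psi>_def)
    moreover have "0 < int_dist (real n * \<alpha> - \<gamma>)"
      using int_dist_annulus(1)[OF n j(1)]
      by (meson less_le_trans zero_less_divide_iff zero_less_numeral zero_less_power)
    ultimately show ?thesis using t \<open>t < n\<close> by (auto simp: T_def)
  qed
  have "1 = C * (1 / C)" using \<open>C > 0\<close> by simp
  also have "\<dots> \<le> C * (\<Sum>t\<in>{T<..T'}. 1 / real t)" using T' \<open>C > 0\<close> by (intro mult_left_mono) auto
  also have "\<dots> = (\<Sum>t\<in>{T<..T'}. C * (1 / real t))" by (rule sum_distrib_left)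
  also have "\<dots> \<le> (\<Sum>t\<in>{T<..T'}. \<Sum>n\<in>layer \<gamma> t. \<psi> \<gamma> \<epsilon> n)"
    unfolding C_def using \<epsilon> by (intro sum_mono sum_\<psi>_layer(1)) (auto simp: T_def)
  finally have S: "1 \<le> (\<Sum>n\<in>F. \<psi> \<gamma> \<epsilon> n)" by (simp only: F_def sum_UN_layer)
  have S\<kappa>: "\<kappa> * (\<Sum>n\<in>F. \<psi> \<gamma> \<epsilon> n) \<le> (\<Sum>n\<in>F. \<psi> \<gamma> \<epsilon> n * (totient n / real n))"
    unfolding F_def sum_UN_layer sum_distrib_left[of \<kappa> _ "{T<..T'}"]
    using \<epsilon> by (intro sum_mono sum_\<psi>_layer(2)) (auto simp: T_def)
  define V where "V = (\<Union>n\<in>F. reduced_approx (\<psi> \<gamma> \<epsilon>) n)"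
  have meas: "2 / 5 * \<kappa>\<^sup>2 \<le> measure lebesgue V" unfolding V_def
    by (rule measure_UN_reduced_approx_ge[OF \<open>finite F\<close> _ _ S _ S\<kappa>]) (use F \<kappa>_pos in force)+
  have V: "\<exists>n a. n \<in> F \<and> a \<in> totatives n \<and> \<bar>\<beta> - real a / n\<bar> < \<psi> \<gamma> \<epsilon> n / n" if "\<beta> \<in> V" for \<beta>
    using that by (auto simp: V_def reduced_approx_def dist_real_def abs_minus_commute)
  have sub: "V \<subseteq> {- 1..2}"
  proof
    fix \<beta> assume "\<beta> \<in> V"
    then obtain n a where na: "n \<in> F" "a \<in> totatives n" "\<bar>\<beta> - real a / n\<bar> < \<psi> \<gamma> \<epsilon> n / n" using V by blast
    have "\<psi> \<gamma> \<epsilon> n / n \<le> 1" using F[OF na(1)] by (simp add: field_simps)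
    moreover have "0 \<le> real a / n" "real a / n \<le> 1" using na(2) by (auto simp: in_totatives_iff)
    ultimately have "- 1 \<le> \<beta>" "\<beta> \<le> 2" using na(3) by linarith+
    then show "\<beta> \<in> {- 1..2}" by simp
  qed
  have "V \<in> lmeasurable" unfolding V_def reduced_approx_def using \<open>finite F\<close>
    by (intro fmeasurable.finite_UN) auto
  moreover have "\<exists>n\<ge>K. real n * (ln n)\<^sup>2 * int_dist (real n * \<alpha> - \<gamma>) * int_dist (real n * \<beta>) < \<epsilon>"
    if "\<beta> \<in> V" for \<beta>
  proof -
    obtain n a where na: "n \<in> F" "a \<in> totatives n" "\<bar>\<beta> - real a / n\<bar> < \<psi> \<gamma> \<epsilon> n / n"
      using V \<open>\<beta> \<in> V\<close> by blast
    define Q where "Q = real n * (ln n)\<^sup>2 * int_dist (real n * \<alpha> - \<gamma>)"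
    have "Q > 0" using F[OF na(1)] by (auto simp: Q_def)
    have "n > 0" using F[OF na(1)] by simp
    have "int_dist (real n * \<beta>) \<le> \<bar>real n * \<beta> - of_int (int a)\<bar>" by (rule int_dist_le)
    also have "real n * \<beta> - of_int (int a) = real n * (\<beta> - real a / n)"
      using \<open>n > 0\<close> by (simp add: field_simps)
    also have "\<bar>\<dots>\<bar> < real n * (\<psi> \<gamma> \<epsilon> n / n)"
      unfolding abs_mult abs_of_nat using na(3) \<open>n > 0\<close> by (intro mult_strict_left_mono) auto
    also have "\<dots> = \<psi> \<gamma> \<epsilon> n" using \<open>n > 0\<close> by simp
    finally have "Q * int_dist (real n * \<beta>) < Q * \<psi> \<gamma> \<epsilon> n" using \<open>Q > 0\<close> by (rule mult_strict_left_mono)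
    also have "\<dots> = \<epsilon>" using \<open>Q > 0\<close> by (simp add: \<psi>_def flip: Q_def)
    finally show ?thesis using F[OF na(1)] by (auto simp: Q_def)
  qed
  ultimately show ?thesis using sub meas by blast
qed

end

section \<open>Limsup sets and the conclusion\<close>

text \<open>The tail unions decrease, have measure at least c, and stay in a bounded interval, so
  their measures are finite and continuity from above applies.\<close>

lemma limsup_set_not_negligible:
  fixes V :: "nat \<Rightarrow> real set"
  assumes V: "\<And>k. V k \<in> lmeasurable" "\<And>k. V k \<subseteq> {a..b}" "\<And>k. c \<le> measure lebesgue (V k)"
    and "c > 0"
  shows "\<not> negligible (\<Inter>k. \<Union>i\<in>{k..}. V i)"
proof
  define D where "D k = (\<Union>i\<in>{k..}. V i)" for k
  assume neg: "negligible (\<Inter>k. \<Union>i\<in>{k..}. V i)"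
  have Ds: "D k \<in> sets lebesgue" for k unfolding D_def
    using V(1) by (intro sets.countable_UN') (auto dest: fmeasurableD)
  have "D k \<subseteq> {a..b}" for k using V(2) by (auto simp: D_def)
  then have Dm: "D k \<in> lmeasurable" for k
    by (intro bounded_set_imp_lmeasurable Ds bounded_subset[OF bounded_closed_interval])
  have "(\<lambda>k. measure lebesgue (D k)) \<longlonglongrightarrow> measure lebesgue (\<Inter>k. D k)"
  proof (rule Lim_measure_decseq)
    show "decseq D" unfolding decseq_def D_def by (intro allI impI UN_mono) auto
    show "range D \<subseteq> sets lebesgue" using Ds by auto
    show "emeasure lebesgue (D i) \<noteq> \<infinity>" for i using Dm[of i] by (auto simp: fmeasurable_def)
  qed
  moreover have "c \<le> measure lebesgue (D k)" for k
  proof -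
    have "measure lebesgue (V k) \<le> measure lebesgue (D k)"
      using V(1) Dm by (intro measure_mono_fmeasurable) (auto simp: D_def dest: fmeasurableD)
    then show ?thesis using V(3)[of k] by linarith
  qed
  ultimately have "c \<le> measure lebesgue (\<Inter>k. D k)" by (intro LIMSEQ_le_const) auto
  moreover have "measure lebesgue (\<Inter>k. D k) = 0"
    using negligible_imp_measure0[OF neg] by (simp add: D_def)
  ultimately show False using \<open>c > 0\<close> by simp
qed

theorem theorem1p2:
  fixes \<alpha> \<gamma> :: real
  assumes "\<alpha> \<notin> \<rat>" and "\<not> Liouville \<alpha>"
  shows "AE \<beta> in lebesgue.
    liminf (\<lambda>n::nat. ereal (real n * (ln (real n))\<^sup>2 *
      int_dist (real n * \<alpha> - \<gamma>) * int_dist (real n * \<beta>))) = 0"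
proof -
  obtain c w where "diophantine \<alpha> c w" using obtain_diophantine[OF assms] .
  then interpret diophantine \<alpha> c w .
  define g where "g n \<beta> = real n * (ln (real n))\<^sup>2 * int_dist (real n * \<alpha> - \<gamma>) * int_dist (real n * \<beta>)"
    for n :: nat and \<beta> :: real
  have g_nonneg: "0 \<le> g n \<beta>" for n \<beta> by (simp add: g_def)
  \<comment> \<open>Only countably many quantifiers occur, so measurability follows from that of
    each \<open>g n\<close>.\<close>
  define W where "W = {\<beta>. \<forall>(m::nat) K. \<exists>n\<ge>K. g n \<beta> < 1 / Suc m}"
  \<comment> \<open>One parameter k controls both the threshold and the size of n, so a point in
    infinitely many \<open>V k\<close> satisfies every instance required by
    \<open>W\<close>.\<close>
  have "\<exists>V\<in>lmeasurable. V \<subseteq> {- 1..2} \<and> 2 / 5 * \<kappa>\<^sup>2 \<le> measure lebesgue V \<and>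
    (\<forall>\<beta>\<in>V. \<exists>n\<ge>k. g n \<beta> < 1 / Suc k)" for k :: nat
    unfolding g_def by (rule exists_large_approximation_set) auto
  then obtain V where V: "\<And>k. V k \<in> lmeasurable" "\<And>k. V k \<subseteq> {- 1..2}"
    "\<And>k. 2 / 5 * \<kappa>\<^sup>2 \<le> measure lebesgue (V k)" "\<And>k \<beta>. \<beta> \<in> V k \<Longrightarrow> \<exists>n\<ge>k. g n \<beta> < 1 / Suc k"
    by metis
  have "(\<Inter>k. \<Union>i\<in>{k..}. V i) \<subseteq> W"
  proof
    fix \<beta> assume \<beta>: "\<beta> \<in> (\<Inter>k. \<Union>i\<in>{k..}. V i)"
    have "\<exists>n\<ge>K. g n \<beta> < 1 / Suc m" for m K :: nat
    proof -
      obtain i where i: "i \<ge> max m K" "\<beta> \<in> V i" using \<beta> by blast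
      then obtain n where n: "n \<ge> i" "g n \<beta> < 1 / Suc i" using V(4) by blast
      have "1 / real (Suc i) \<le> 1 / Suc m" using i by (intro divide_left_mono) auto
      then show ?thesis using n i by (intro exI[of _ n]) auto
    qed
    then show "\<beta> \<in> W" by (simp add: W_def)
  qed
  moreover have "\<not> negligible (\<Inter>k. \<Union>i\<in>{k..}. V i)"
    using limsup_set_not_negligible[of V "- 1" 2 "2 / 5 * \<kappa>\<^sup>2"] V(1-3) \<kappa>_pos by auto
  ultimately have "\<not> negligible W" using negligible_subset by blast
  moreover have "W \<in> sets lebesgue"
  proof -
    have [measurable]: "g n \<in> borel_measurable borel" for n
      unfolding g_def by (intro borel_measurable_continuous_onI continuous_intros)
    have "{\<beta> \<in> space borel. \<forall>(m::nat) K. \<exists>n\<ge>K. g n \<beta> < 1 / Suc m} \<in> sets borel" by measurable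
    then have "W \<in> sets borel" by (simp add: W_def)
    then show ?thesis by (simp add: sets_completionI_sets)
  qed
  moreover have "\<beta> + of_int k \<in> W" if "\<beta> \<in> W" for \<beta> k
  proof -
    have "g n (\<beta> + of_int k) = g n \<beta>" for n
    proof -
      have "real n * (\<beta> + of_int k) = real n * \<beta> + of_int (int n * k)" by (simp add: algebra_simps)
      then show ?thesis unfolding g_def by (simp only: int_dist_add_int)
    qed
    then show ?thesis using that by (simp add: W_def)
  qed
  moreover have "2 * \<beta> \<in> W" if "\<beta> \<in> W" for \<beta>
  proof -
    have g2: "g n (2 * \<beta>) \<le> 2 * g n \<beta>" for n
    proof -
      have "int_dist (real n * (2 * \<beta>)) \<le> 2 * int_dist (real n * \<beta>)"
        using int_dist_mult_nat_le[of 2 "real n * \<beta>"] by (simp add: mult_ac)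
      then have "real n * (ln (real n))\<^sup>2 * int_dist (real n * \<alpha> - \<gamma>) * int_dist (real n * (2 * \<beta>))
        \<le> real n * (ln (real n))\<^sup>2 * int_dist (real n * \<alpha> - \<gamma>) * (2 * int_dist (real n * \<beta>))"
        by (intro mult_left_mono) auto
      then show ?thesis by (simp add: g_def)
    qed
    have "\<exists>n\<ge>K. g n (2 * \<beta>) < 1 / Suc m" for m K :: nat
    proof -
      \<comment> \<open>Doubling \<open>\<beta>\<close> at most doubles g, so the index is chosen
        with \<open>2 / Suc (2 * m + 1) = 1 / Suc m\<close>.\<close>
      obtain n where "n \<ge> K" "g n \<beta> < 1 / Suc (2 * m + 1)"
        using \<open>\<beta> \<in> W\<close> unfolding W_def by blast
      moreover have "2 * (1 / real (Suc (2 * m + 1))) = 1 / Suc m" by (simp add: field_simps)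
      ultimately show ?thesis using g2[of n] by (intro exI[of _ n]) linarith
    qed
    then show ?thesis by (simp add: W_def)
  qed
  ultimately have "AE \<beta> in lebesgue. \<beta> \<in> W" by (intro zero_one_law_doubling) auto
  then show ?thesis
  proof eventually_elim
    case (elim \<beta>)
    then have "liminf (\<lambda>n. ereal (g n \<beta>)) = 0"
      by (intro liminf_ereal_eq_0 g_nonneg) (auto simp: W_def)
    then show ?case by (simp add: g_def)
  qed
qed

end
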